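(* Assume the Generalized Riemann Hypothesis. For every $\varepsilon>0$ there is a constant $C_\varepsilon>0$ such that the following holds. Let $B$ be a set of $n$ complex numbers and let $B.B=\{bb' : b,b'\in B\}$. If $B.B$ contains an arithmetic progression $\{a, a+d, \ldots, a+(N-1)d\}$ of complex numbers with nonzero common difference $d$ and $N$ terms, then $N\le C_\varepsilon\, n^{1+\varepsilon}$. *)

theory Defs
  imports "HOL-Analysis.Analysis" "HOL-Computational_Algebra.Polynomial"
begin

text \<open>Number fields, realised as subfields of the complex numbers that are
finite-dimensional over the rationals (every number field embeds in C).\<close>
definition number_field :: "complex set \<Rightarrow> bool" where
  "number_field K \<longleftrightarrow>
     0 \<in> K \<and> 1 \<in> K \<and>
     (\<forall>x\<in>K. \<forall>y\<in>K. x + y \<in> K \<and> x - y \<in> K \<and> x * y \<in> K) \<and>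
     (\<forall>x\<in>K. x \<noteq> 0 \<longrightarrow> inverse x \<in> K) \<and>
     (\<exists>S. finite S \<and> S \<subseteq> K \<and>
        (\<forall>x\<in>K. \<exists>q. (\<forall>s\<in>S. q s \<in> \<rat>) \<and> x = (\<Sum>s\<in>S. q s * s)))"

definition algebraic_integer :: "complex \<Rightarrow> bool" where
  "algebraic_integer x \<longleftrightarrow>
     (\<exists>p :: int poly. lead_coeff p = 1 \<and> poly (map_poly of_int p) x = 0)"

definition ring_of_integers :: "complex set \<Rightarrow> complex set" where
  "ring_of_integers K = {x \<in> K. algebraic_integer x}"

definition is_ideal :: "complex set \<Rightarrow> complex set \<Rightarrow> bool" where
  "is_ideal R I \<longleftrightarrow> I \<subseteq> R \<and> 0 \<in> I \<and>
     (\<forall>x\<in>I. \<forall>y\<in>I. x + y \<in> I) \<and> (\<forall>r\<in>R. \<forall>x\<in>I. r * x \<in> I)"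

definition ideal_norm :: "complex set \<Rightarrow> complex set \<Rightarrow> nat" where
  "ideal_norm R I = card ((\<lambda>x. (\<lambda>i. x + i) ` I) ` R)"

definition ideal_count :: "complex set \<Rightarrow> nat \<Rightarrow> nat" where
  "ideal_count K m = card {I. is_ideal (ring_of_integers K) I \<and> I \<noteq> {0} \<and>
                              ideal_norm (ring_of_integers K) I = m}"

text \<open>Generalized Riemann Hypothesis (for Dedekind zeta functions of all number
fields): the analytic continuation of zeta_K to C - {1}, i.e. any holomorphic
function on C - {1} agreeing with the Dirichlet series on Re s > 1, has all its
zeros in the critical strip 0 < Re s < 1 on the line Re s = 1/2.\<close>
definition GRH :: bool where
  "GRH \<longleftrightarrow>
     (\<forall>K f. number_field K \<and> f holomorphic_on (- {1}) \<and>
        (\<forall>s. 1 < Re s \<longrightarrow>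
           (\<lambda>m. of_nat (ideal_count K m) / (of_nat m) powr s) sums f s) \<longrightarrow>
        (\<forall>s. f s = 0 \<and> 0 < Re s \<and> Re s < 1 \<longrightarrow> Re s = 1/2))"

end

(*
  Put rho = -a/d, so that the products are d (k - rho) for k < N, and view them as the edges of a
  graph on B. If N is much larger than n log n, there are two distinct short walks with increasing
  edge labels, equal ends and equal parity; comparing their alternating products shows that rho is a
  root of an integer polynomial of degree O(log n). Let f be its primitive minimal polynomial, of
  degree D. For most k we have |f(k)| > N^(D nu) with nu < 1 close to 1, while on average over k the
  primes p <= M = N^mu, mu < nu, contribute at most M^D up to a constant: p-adically f has at most D
  roots, so its p-part behaves like that of D factorials. Hence a positive proportion of the k have
  a prime p > M dividing f(k). Each such p accounts for at most N/M + 1 values of k, so we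
  can choose about M of the k that are triangular with respect to their primes. Reduction
  modulo these primes (rho maps to k) shows that the chosen d (k - rho) have no multiplicative
  relation among equally many factors. By pigeonhole on the exponent vectors over B,
  their number is at most n log N up to a constant.
*)
theory Submission
  imports Defs "HOL-Real_Asymp.Real_Asymp"
begin

section \<open>Chebyshev and Mertens upper bounds\<close>

lemma prod_primes_dvd:
  fixes m :: nat
  assumes "finite P" "\<And>p. p \<in> P \<Longrightarrow> prime p" "\<And>p. p \<in> P \<Longrightarrow> p dvd m"
  shows "\<Prod>P dvd m"
  using assms
proof (induction P rule: finite_induct)
  case (insert p P)
  have "coprime p (\<Prod>P)"
    using insert by (intro prod_coprime_right) (auto intro!: primes_coprime)
  thus ?case using insert by (simp add: divides_mult)
qed auto

text \<open>By symmetry the first half of row 2m + 1 of Pascal's triangle sums to 2^(2m) = 4^m, and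
  the middle coefficient is one of its terms.\<close>

lemma choose_middle_odd_le: "(2 * m + 1) choose m \<le> (4::nat) ^ m"
proof -
  have "(2 * m + 1) choose m \<le> (\<Sum>k\<le>m. (2 * m + 1) choose k)"
    by (rule member_le_sum) auto
  also have "\<dots> = 4 ^ m"
    by (subst binomial_r_part_sum) (simp add: power_mult)
  finally show ?thesis .
qed

text \<open>Erdos' induction. For n = 2m + 1 the primes above m + 1 all divide the middle binomial
  coefficient, which is at most 4^m, and the smaller primes contribute at most 4^(m + 1) by
  induction. An even n > 2 adds no prime.\<close>

lemma prod_primes_le_4_power: "(\<Prod>p | prime p \<and> p \<le> n. p) \<le> (4::nat) ^ n"
proof (induction n rule: less_induct)
  case (less n)
  define P where "P = (\<lambda>n::nat. {p::nat. prime p \<and> p \<le> n})"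
  have fin: "finite (P k)" for k by (auto simp: P_def)
  have IH: "\<Prod>(P k) \<le> 4 ^ k" if "k < n" for k using less[OF that] by (simp add: P_def)
  consider "n \<le> 1" | "n = 2" | "n > 2" "even n" | "n > 2" "odd n" by linarith
  hence "\<Prod>(P n) \<le> 4 ^ n"
  proof cases
    case 1
    hence "P n = {}" by (auto simp: P_def dest: prime_gt_1_nat)
    thus ?thesis by simp
  next
    case 2
    hence "P n = {2}" by (auto simp: P_def dest: prime_ge_2_nat)
    thus ?thesis by (simp add: 2)
  next
    case 3
    have "\<not> prime n" using 3 prime_odd_nat by auto
    hence "P n = P (n - 1)" by (auto simp: P_def le_less)
    moreover have "(4::nat) ^ (n - 1) \<le> 4 ^ n" by (intro power_increasing) auto
    ultimately show ?thesis using IH[of "n - 1"] 3 by (metis diff_less less_trans le_trans zero_less_numeral zero_less_one)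
  next
    case 4
    then obtain m where m: "n = 2 * m + 1" by (elim oddE)
    hence m0: "m > 0" using 4 by simp
    define Q where "Q = {p \<in> P n. p > m + 1}"
    have PQ: "P n = P (m + 1) \<union> Q" "P (m + 1) \<inter> Q = {}"
      using m by (auto simp: P_def Q_def)
    have "\<Prod>Q dvd (2 * m + 1) choose m"
    proof (rule prod_primes_dvd)
      fix p assume p: "p \<in> Q"
      have "fact m * fact (2 * m + 1 - m) * ((2 * m + 1) choose m) = (fact (2 * m + 1) :: nat)"
        by (rule binomial_fact_lemma) auto
      moreover have "p dvd fact (2 * m + 1)"
        using p m by (subst prime_dvd_fact_iff) (auto simp: Q_def P_def)
      moreover have "\<not> p dvd fact m" "\<not> p dvd fact (2 * m + 1 - m)"
        using p by (subst prime_dvd_fact_iff; simp add: Q_def P_def)+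
      ultimately show "p dvd (2 * m + 1) choose m"
        using p unfolding Q_def P_def mem_Collect_eq by (metis prime_dvd_mult_iff)
    qed (auto simp: Q_def P_def)
    hence "\<Prod>Q \<le> (2 * m + 1) choose m" by (intro dvd_imp_le) auto
    with choose_middle_odd_le have "\<Prod>Q \<le> 4 ^ m" using order_trans by blast
    hence "\<Prod>(P (m+1)) * \<Prod>Q \<le> 4 ^ (m + 1) * 4 ^ m"
      using IH[of "m + 1"] m m0 by (intro mult_mono) auto
    thus ?thesis using PQ fin[of n] by (simp add: m prod.union_disjoint power_add mult_2)
  qed
  thus ?case by (simp add: P_def)
qed

lemma sum_ln_primes_le: "(\<Sum>p | prime p \<and> p \<le> n. ln (real p)) \<le> real n * ln 4"
proof -
  have "(\<Sum>p | prime p \<and> p \<le> n. ln (real p)) = ln (\<Prod>p | prime p \<and> p \<le> n. real p)"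
    by (rule ln_prod [symmetric]) (auto dest: prime_gt_0_nat)
  also have "\<dots> = ln (real (\<Prod>p | prime p \<and> p \<le> n. p))" by simp
  also have "\<dots> \<le> ln (real (4 ^ n))"
  proof -
    have "(\<Prod>p | prime p \<and> p \<le> n. p) > 0" by (intro prod_pos) (auto simp: prime_gt_0_nat)
    moreover have "real (\<Prod>p | prime p \<and> p \<le> n. p) \<le> real (4 ^ n)"
      using prod_primes_le_4_power[of n] by (rule of_nat_mono)
    ultimately show ?thesis by (subst ln_le_cancel_iff) (auto simp del: of_nat_prod of_nat_power intro: prime_gt_0_nat)
  qed
  finally show ?thesis by (simp add: ln_realpow)
qed

lemma ln_eq_sum_multiplicity:
  fixes m :: nat
  assumes "m > 0" "finite P" "\<And>p. p \<in> P \<Longrightarrow> prime p" "prime_factors m \<subseteq> P"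
  shows "ln (real m) = (\<Sum>p\<in>P. real (multiplicity p m) * ln (real p))"
proof -
  have "m = (\<Prod>p\<in>prime_factors m. p ^ multiplicity p m)"
    using assms by (intro prime_factorization_nat) auto
  also have "\<dots> = (\<Prod>p\<in>P. p ^ multiplicity p m)"
    using assms by (intro prod.mono_neutral_left) (auto simp: prime_factors_multiplicity)
  finally have "real m = (\<Prod>p\<in>P. real p ^ multiplicity p m)"
    by (metis (no_types, lifting) of_nat_power of_nat_prod prod.cong)
  also have "ln \<dots> = (\<Sum>p\<in>P. ln (real p ^ multiplicity p m))"
    using assms by (intro ln_prod) (auto simp: prime_gt_0_nat)
  also have "\<dots> = (\<Sum>p\<in>P. real (multiplicity p m) * ln (real p))"
    using assms by (intro sum.cong) (auto simp: ln_realpow prime_gt_0_nat)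
  finally show ?thesis .
qed

text \<open>Legendre's formula for the exponent of \<open>p\<close> in n!, in recursive form: only
  the multiples \<open>p * j\<close> contribute, and each contributes one more than \<open>j\<close>
  does.\<close>

lemma sum_multiplicity_rec:
  fixes p :: nat
  assumes "prime p"
  shows "(\<Sum>j=1..n. multiplicity p j) = n div p + (\<Sum>j=1..n div p. multiplicity p j)"
proof -
  have p0: "p > 0" using assms prime_gt_0_nat by blast
  have "(\<Sum>j=1..n. multiplicity p j) = (\<Sum>j\<in>(*) p ` {1..n div p}. multiplicity p j)"
  proof (rule sum.mono_neutral_right)
    show "(*) p ` {1..n div p} \<subseteq> {1..n}"
    proof
      fix i assume "i \<in> (*) p ` {1..n div p}"
      then obtain j where j: "i = p * j" "1 \<le> j" "j \<le> n div p"
        by (metis (no_types, lifting) atLeastAtMost_iff imageE)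
      hence "p * j \<le> n" by (metis mult.commute less_eq_div_iff_mult_less_eq p0)
      thus "i \<in> {1..n}" using j p0 by auto
    qed
    show "\<forall>i\<in>{1..n} - (*) p ` {1..n div p}. multiplicity p i = 0"
    proof
      fix i assume i: "i \<in> {1..n} - (*) p ` {1..n div p}"
      have "\<not> p dvd i"
      proof
        assume "p dvd i"
        then obtain j where j: "i = p * j" by auto
        have "j \<le> n div p" using i j p0 by (auto simp: less_eq_div_iff_mult_less_eq mult.commute)
        moreover have "j \<ge> 1" using i j by (cases j) auto
        ultimately have "i \<in> (*) p ` {1..n div p}" unfolding j by (intro imageI) simp
        thus False using i by simp
      qed
      thus "multiplicity p i = 0" by (rule not_dvd_imp_multiplicity_0)
    qed
  qed simp
  also have "\<dots> = (\<Sum>j=1..n div p. multiplicity p (p * j))"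
    using p0 by (subst sum.reindex) (auto simp: inj_on_def)
  also have "\<dots> = (\<Sum>j=1..n div p. 1 + multiplicity p j)"
    using assms p0 by (intro sum.cong refl, subst multiplicity_times_same) auto
  finally show ?thesis by (simp add: sum_Suc)
qed

text \<open>Legendre's bound n / (p - 1) for the exponent of \<open>p\<close> in n!, by induction
  through \<open>n div p\<close>. Its denominator is the reason why ln p / (p - 1) is summed in
  \<open>mertens_upper_bound\<close>.\<close>

lemma sum_multiplicity_le:
  fixes p :: nat
  assumes "prime p"
  shows "(p - 1) * (\<Sum>j=1..n. multiplicity p j) \<le> n"
proof (induction n rule: less_induct)
  case (less n)
  have p: "p > 1" using assms prime_gt_1_nat by blast
  show ?case
  proof (cases "n = 0")
    case False
    define q where "q = n div p"
    have "(p - 1) * (\<Sum>j=1..n. multiplicity p j) = (p - 1) * q + (p - 1) * (\<Sum>j=1..q. multiplicity p j)"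
      by (subst sum_multiplicity_rec[OF assms]) (simp add: q_def algebra_simps)
    also have "\<dots> \<le> (p - 1) * q + q"
      using less[of q] False p by (intro add_left_mono) (auto simp: q_def)
    also have "\<dots> = p * q" using p by (cases p) auto
    also have "\<dots> \<le> n" by (simp add: q_def)
    finally show ?thesis .
  qed auto
qed

text \<open>Factor each j up to n into primes and exchange the sums; then keep only the first term
  \<open>n div p\<close> of Legendre's formula.\<close>

lemma ln_fact_ge_sum_primes:
  "ln (fact n) \<ge> (\<Sum>p | prime p \<and> p \<le> n. real (n div p) * ln (real p))"
proof -
  define P where "P = {p::nat. prime p \<and> p \<le> n}"
  have fin: "finite P" by (auto simp: P_def)
  have "(\<Sum>p\<in>P. real (n div p) * ln (real p))
      \<le> (\<Sum>p\<in>P. real (\<Sum>j=1..n. multiplicity p j) * ln (real p))"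
  proof (rule sum_mono, rule mult_right_mono)
    fix p assume p: "p \<in> P"
    hence "prime p" by (simp add: P_def)
    from sum_multiplicity_rec[OF this, of n]
    show "real (n div p) \<le> real (\<Sum>j=1..n. multiplicity p j)"
      by (simp del: of_nat_sum)
    show "ln (real p) \<ge> 0" using prime_ge_1_nat[OF \<open>prime p\<close>] by simp
  qed
  also have "\<dots> = (\<Sum>p\<in>P. \<Sum>j=1..n. real (multiplicity p j) * ln (real p))"
    by (simp add: sum_distrib_right)
  also have "\<dots> = (\<Sum>j=1..n. \<Sum>p\<in>P. real (multiplicity p j) * ln (real p))"
    by (rule sum.swap)
  also have "\<dots> = (\<Sum>j=1..n. ln (real j))"
  proof (rule sum.cong [OF refl], rule ln_eq_sum_multiplicity [symmetric])
    fix j assume "j \<in> {1..n}"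
    thus "prime_factors j \<subseteq> P" by (auto simp: P_def prime_factors_dvd dest!: dvd_imp_le)
  qed (auto simp: P_def)
  also have "\<dots> = ln (fact n)"
    by (simp add: fact_prod ln_prod del: of_nat_prod flip: of_nat_prod) (subst of_nat_prod, subst ln_prod, auto)
  finally show ?thesis by (simp add: P_def)
qed

text \<open>Mertens' argument: replacing \<open>n div p\<close> by n / p costs at most the Chebyshev
  sum of ln p, which is O(n), and the main term is bounded by n! <= n^n.\<close>

lemma sum_ln_primes_div_le:
  assumes "n > 0"
  shows "(\<Sum>p | prime p \<and> p \<le> n. ln (real p) / real p) \<le> ln (real n) + ln 4"
proof -
  define P where "P = {p::nat. prime p \<and> p \<le> n}"
  have "real n * (\<Sum>p\<in>P. ln (real p) / real p) = (\<Sum>p\<in>P. (real n / real p) * ln (real p))"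
    by (simp add: sum_distrib_left)
  also have "\<dots> \<le> (\<Sum>p\<in>P. (real (n div p) + 1) * ln (real p))"
  proof (rule sum_mono, rule mult_right_mono)
    fix p assume "p \<in> P"
    hence p: "p > 0" by (auto simp: P_def prime_gt_0_nat)
    show "real n / real p \<le> real (n div p) + 1"
      using real_of_int_floor_add_one_ge[where r = "real n / real p"] by (simp add: floor_divide_of_nat_eq)
    show "ln (real p) \<ge> 0" using p by simp
  qed
  also have "\<dots> = (\<Sum>p\<in>P. real (n div p) * ln (real p)) + (\<Sum>p\<in>P. ln (real p))"
    by (simp add: algebra_simps sum.distrib)
  also have "\<dots> \<le> ln (fact n) + real n * ln 4"
    using ln_fact_ge_sum_primes[of n] sum_ln_primes_le[of n] by (simp add: P_def)
  also have "ln (fact n) \<le> ln (real n ^ n)"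
    using fact_le_power[of n, where ?'a = real] assms by (subst ln_le_cancel_iff) auto
  also have "\<dots> = real n * ln (real n)" using assms by (simp add: ln_realpow)
  finally have "real n * (\<Sum>p\<in>P. ln (real p) / real p) \<le> real n * (ln (real n) + ln 4)"
    by (simp add: algebra_simps)
  thus ?thesis using assms by (simp add: P_def)
qed

lemma ln_le_2_sqrt: "x > 0 \<Longrightarrow> ln x \<le> 2 * sqrt x"
  using ln_le_minus_one[of "sqrt x"] by (simp add: ln_sqrt)

text \<open>Passing from p to p - 1 in the denominator costs ln p / (p (p - 1)). With ln p <= 2 sqrt
  p and p - 1 >= p / 2 this is at most 4 p^(-3/2), the term of a convergent series.\<close>

lemma mertens_upper_bound:
  obtains C where "\<And>n. n > 0 \<Longrightarrow>
    (\<Sum>p | prime p \<and> p \<le> n. ln (real p) / (real p - 1)) \<le> ln (real n) + C"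
proof -
  define g where "g = (\<lambda>k::nat. 4 * real k powr (-3/2))"
  have sg: "summable g"
    unfolding g_def by (intro summable_mult) (simp add: summable_real_powr_iff)
  have "(\<Sum>p | prime p \<and> p \<le> n. ln (real p) / (real p - 1)) \<le> ln (real n) + (ln 4 + suminf g)"
    if n: "n > 0" for n
  proof -
    define P where "P = {p::nat. prime p \<and> p \<le> n}"
    have "(\<Sum>p\<in>P. ln (real p) / (real p - 1)) \<le> (\<Sum>p\<in>P. ln (real p) / real p + g p)"
    proof (rule sum_mono)
      fix p assume "p \<in> P"
      hence p: "p \<ge> 2" by (auto simp: P_def prime_ge_2_nat)
      have "ln (real p) / (real p - 1) - ln (real p) / real p = ln (real p) / (real p * (real p - 1))"
        using p by (simp add: field_simps)
      also have "\<dots> \<le> (2 * sqrt (real p)) / (real p * (real p / 2))"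
        using p ln_le_2_sqrt[of "real p"] by (intro frac_le mult_left_mono) auto
      also have "\<dots> = g p"
        using p powr_add[of "real p" "1/2" "3/2"]
        by (simp add: g_def powr_minus powr_half_sqrt [symmetric] field_simps power2_eq_square)
      finally show "ln (real p) / (real p - 1) \<le> ln (real p) / real p + g p" by simp
    qed
    also have "\<dots> = (\<Sum>p\<in>P. ln (real p) / real p) + (\<Sum>p\<in>P. g p)" by (rule sum.distrib)
    also have "(\<Sum>p\<in>P. g p) \<le> suminf g"
      using sg by (intro sum_le_suminf) (auto simp: P_def g_def)
    also have "(\<Sum>p\<in>P. ln (real p) / real p) \<le> ln (real n) + ln 4"
      using sum_ln_primes_div_le[OF n] by (simp add: P_def)
    finally show ?thesis by (simp add: P_def)
  qed
  thus thesis by (rule that)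
qed

section \<open>Values of integer polynomials\<close>

lemma poly_synthetic_division:
  fixes f :: "'a::comm_ring_1 poly"
  shows "poly f x = poly f c + (x - c) * poly (synthetic_div f c) x"
proof -
  have "poly f x = poly ([:-c, 1:] * synthetic_div f c + [:poly f c:]) x"
    by (rule arg_cong[OF synthetic_div_correct'[symmetric]])
  thus ?thesis by (simp add: algebra_simps)
qed

text \<open>Comparing divisibility by all powers instead of multiplicities includes the case that
  \<open>g\<close> vanishes somewhere: 0 is divisible by every power.\<close>

lemma exists_prime_power_maximizer:
  fixes g :: "'a \<Rightarrow> 'b::comm_semiring_1"
  assumes "finite K" "K \<noteq> {}"
  shows "\<exists>e\<in>K. \<forall>k\<in>K. \<forall>t. p ^ t dvd g k \<longrightarrow> p ^ t dvd g e"
  using assms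
proof (induction K rule: finite_ne_induct)
  case (insert x K)
  then obtain e where e: "e \<in> K" "\<And>k t. k \<in> K \<Longrightarrow> p ^ t dvd g k \<Longrightarrow> p ^ t dvd g e" by blast
  show ?case
  proof (cases "\<forall>t. p ^ t dvd g x \<longrightarrow> p ^ t dvd g e")
    case False
    then obtain t where t: "p ^ t dvd g x" "\<not> p ^ t dvd g e" by blast
    have "p ^ s dvd g x" if "p ^ s dvd g e" for s
    proof -
      have "s \<le> t" using that t(2) power_le_dvd[of p s "g e" t] by linarith
      thus ?thesis using t(1) by (rule power_le_dvd[rotated])
    qed
    thus ?thesis using e by blast
  qed (use e in blast)
qed auto

text \<open>The points \<open>es\<close> play the role of the integers that are \<open>p\<close>-adically closest to the
  roots of \<open>f\<close>: choosing \<open>e\<close> with \<open>f e\<close> maximally divisible by \<open>p\<close>, the factorisation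
  \<open>f k - f e = (k - e) * g k\<close> bounds the \<open>p\<close>-part of \<open>f k\<close> by that of \<open>(k - e) * g k\<close>.\<close>

lemma prime_power_dvd_poly_bound:
  fixes f :: "int poly" and p :: int
  assumes "prime p" "\<not> [:p:] dvd f" "degree f \<le> D" "finite K"
  shows "\<exists>es. length es \<le> D \<and> set es \<subseteq> K \<and>
           (\<forall>k\<in>K. \<forall>t. p ^ t dvd poly f k \<longrightarrow> p ^ t dvd (\<Prod>e\<leftarrow>es. k - e))"
  using assms(2,3)
proof (induction D arbitrary: f)
  case 0
  then obtain c where c: "f = [:c:]" using degree_eq_zeroE by blast
  have "\<not> p dvd c" using 0 by (simp add: c)
  hence "t = 0" if "p ^ t dvd c" for t using that by (metis dvd_power dvd_trans gr0I)
  thus ?case by (intro exI[of _ "[]"]) (fastforce simp: c)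
next
  case (Suc D)
  show ?case
  proof (cases "K = {}")
    case False
    obtain e where e: "e \<in> K" "\<And>k t. k \<in> K \<Longrightarrow> p ^ t dvd poly f k \<Longrightarrow> p ^ t dvd poly f e"
      using exists_prime_power_maximizer[OF assms(4) False, of p "poly f"] by blast
    define g where "g = synthetic_div f e"
    have f: "poly f k = poly f e + (k - e) * poly g k" for k
      unfolding g_def by (rule poly_synthetic_division)
    show ?thesis
    proof (cases "[:p:] dvd g")
      \<comment> \<open>If \<open>p\<close> divides g, it cannot divide f e as well, since f would
        then be divisible by \<open>p\<close>. By maximality of e, no value f k on K is divisible by
        \<open>p\<close>, and the empty list will do.\<close>
      case True
      hence "[:p:] dvd [:-e, 1:] * g" by (rule dvd_mult)
      moreover have "[:-e, 1:] * g + [:poly f e:] = f"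
        unfolding g_def by (rule synthetic_div_correct')
      ultimately have "\<not> [:p:] dvd [:poly f e:]" using Suc.prems(1) by (metis dvd_add)
      hence "\<not> p dvd poly f e" by simp
      hence "t = 0" if "k \<in> K" "p ^ t dvd poly f k" for t k
        using e(2)[OF that] by (metis dvd_power dvd_trans gr0I)
      thus ?thesis by (intro exI[of _ "[]"]) fastforce
    next
      case False
      have "degree g \<le> D" using Suc.prems(2) by (simp add: g_def degree_synthetic_div)
      from Suc.IH[OF False this] obtain es where es: "length es \<le> D" "set es \<subseteq> K"
        "\<And>k t. k \<in> K \<Longrightarrow> p ^ t dvd poly g k \<Longrightarrow> p ^ t dvd (\<Prod>e\<leftarrow>es. k - e)" by blast
      have "p ^ t dvd (\<Prod>e\<leftarrow>e # es. k - e)" if k: "k \<in> K" "p ^ t dvd poly f k" for k t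
      proof -
        \<comment> \<open>By the choice of e, p^t also divides f e, hence the difference f k - f e.
          The power then splits between the two factors because \<open>p\<close> is prime.\<close>
        have "p ^ t dvd (k - e) * poly g k"
          using e(2)[OF k] k(2) f[of k] by (metis add_diff_cancel_left' dvd_diff)
        then obtain i j where ij: "i + j = t" "p ^ i dvd k - e" "p ^ j dvd poly g k"
          using prime_elem_power_dvd_prod[of p t] \<open>prime p\<close> by blast
        from mult_dvd_mono[OF ij(2) es(3)[OF k(1) ij(3)]] show ?thesis
          by (simp add: power_add flip: ij(1))
      qed
      with es e(1) show ?thesis by (intro exI[of _ "e # es"]) auto
    qed
  qed (auto intro: exI[of _ "[]"])
qed

text \<open>The archimedean counterpart of \<open>prime_power_dvd_poly_bound\<close>: now e
  minimises the absolute value of f on K, so |f k - f e| <= 2 |f k|, which costs a factor 2 per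
  degree. The induction ends at a nonzero integer constant.\<close>

lemma abs_poly_lower_bound:
  fixes f :: "int poly"
  assumes "f \<noteq> 0" "degree f = D" "finite K" "K \<noteq> {}"
  shows "\<exists>es. length es = D \<and> set es \<subseteq> K \<and>
           (\<forall>k\<in>K. \<bar>\<Prod>e\<leftarrow>es. k - e\<bar> \<le> 2 ^ D * \<bar>poly f k\<bar>)"
  using assms(1,2)
proof (induction D arbitrary: f)
  case 0
  then obtain c where c: "f = [:c:]" using degree_eq_zeroE by blast
  thus ?case using 0 by (intro exI[of _ "[]"]) auto
next
  case (Suc D)
  define e where "e = arg_min_on (\<lambda>k. \<bar>poly f k\<bar>) K"
  have e: "e \<in> K" "\<And>k. k \<in> K \<Longrightarrow> \<bar>poly f e\<bar> \<le> \<bar>poly f k\<bar>"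
    using arg_min_if_finite[OF assms(3,4), of "\<lambda>k. \<bar>poly f k\<bar>"]
    by (auto simp: e_def not_less)
  define g where "g = synthetic_div f e"
  have f: "poly f k = poly f e + (k - e) * poly g k" for k
    unfolding g_def by (rule poly_synthetic_division)
  have deg: "degree g = D" using Suc.prems(2) by (simp add: g_def degree_synthetic_div)
  have "g \<noteq> 0"
    using Suc.prems by (auto simp: g_def synthetic_div_eq_0_iff)
  from Suc.IH[OF this deg] obtain es where es: "length es = D" "set es \<subseteq> K"
    "\<And>k. k \<in> K \<Longrightarrow> \<bar>\<Prod>e\<leftarrow>es. k - e\<bar> \<le> 2 ^ D * \<bar>poly g k\<bar>" by blast
  have "\<bar>\<Prod>e\<leftarrow>e # es. k - e\<bar> \<le> 2 ^ Suc D * \<bar>poly f k\<bar>" if k: "k \<in> K" for k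
  proof -
    have "\<bar>\<Prod>e\<leftarrow>e # es. k - e\<bar> = \<bar>k - e\<bar> * \<bar>\<Prod>e\<leftarrow>es. k - e\<bar>" by (simp add: abs_mult)
    also have "\<dots> \<le> \<bar>k - e\<bar> * (2 ^ D * \<bar>poly g k\<bar>)"
      using es(3)[OF k] by (intro mult_left_mono) auto
    also have "\<dots> = 2 ^ D * \<bar>poly f k - poly f e\<bar>"
      using f[of k] by (simp add: abs_mult)
    also have "\<dots> \<le> 2 ^ D * (2 * \<bar>poly f k\<bar>)"
      using e(2)[OF k] by (intro mult_left_mono) auto
    finally show ?thesis by simp
  qed
  with es e(1) show ?case by (intro exI[of _ "e # es"]) auto
qed

section \<open>Primitive integer minimal polynomials\<close>

lemma map_poly_of_int_add: "map_poly of_int (p + q) = map_poly of_int p + (map_poly of_int q :: 'a::ring_1 poly)"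
  by (rule poly_eqI) (simp add: coeff_map_poly)

lemma map_poly_of_int_mult: "map_poly of_int (p * q) = map_poly of_int p * (map_poly of_int q :: 'a::comm_ring_1 poly)"
  by (rule poly_eqI) (simp add: coeff_map_poly coeff_mult)

lemma map_poly_of_int_smult: "map_poly of_int (smult c p) = smult (of_int c) (map_poly of_int p :: 'a::comm_ring_1 poly)"
  by (rule poly_eqI) (simp add: coeff_map_poly)

text \<open>Gauss's lemma: contents multiply, so \<open>c\<close> divides the content of the
  cofactor and can be cancelled.\<close>

lemma primitive_dvd_smultD:
  fixes f g :: "int poly"
  assumes "content f = 1" "c \<noteq> 0" "f dvd smult c g"
  shows "f dvd g"
proof -
  from assms(3) obtain h where h: "smult c g = f * h" by (elim dvdE)
  have "content (smult c g) = content h" by (simp add: h content_mult assms(1))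
  hence "content h = normalize c * content g" by simp
  hence "c dvd content h" by simp
  hence "[:c:] dvd h" by (simp add: const_poly_dvd_iff_dvd_content)
  then obtain h' where "h = smult c h'" by (elim dvdE) simp
  with h have "smult c g = smult c (f * h')" by simp
  hence "smult c (g - f * h') = 0" by (simp add: smult_diff_right)
  hence "g = f * h'" using assms(2) by simp
  thus ?thesis by simp
qed

text \<open>Take the primitive part of a nonzero annihilator of least degree. Pseudo-division of any
  other annihilator leaves remainder 0 by minimality, and \<open>primitive_dvd_smultD\<close>
  removes the multiplier that pseudo-division introduces.\<close>

lemma exists_primitive_int_minimal_poly:
  fixes x :: complex and h :: "int poly"
  assumes "h \<noteq> 0" "poly (map_poly of_int h) x = 0"
  obtains f :: "int poly" where "f \<noteq> 0" "content f = 1" "0 < degree f" "degree f \<le> degree h"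
    "\<And>q. poly (map_poly of_int q) x = 0 \<Longrightarrow> f dvd q"
proof -
  define ev where "ev = (\<lambda>q :: int poly. poly (map_poly of_int q) x)"
  have ev: "ev (p + q) = ev p + ev q" "ev (p * q) = ev p * ev q" "ev (smult c p) = of_int c * ev p"
    for p q c
    by (simp_all add: ev_def map_poly_of_int_add map_poly_of_int_mult map_poly_of_int_smult)
  define f0 where "f0 = arg_min degree (\<lambda>q. q \<noteq> 0 \<and> ev q = 0)"
  have h: "h \<noteq> 0 \<and> ev h = 0" using assms by (simp add: ev_def)
  have f0: "f0 \<noteq> 0" "ev f0 = 0"
    using arg_min_natI[of "\<lambda>q. q \<noteq> 0 \<and> ev q = 0", OF h, of degree] by (auto simp: f0_def)
  have min: "degree f0 \<le> degree q" if "q \<noteq> 0" "ev q = 0" for q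
    unfolding f0_def by (rule arg_min_nat_le) (use that in auto)
  define f where "f = primitive_part f0"
  have f: "f \<noteq> 0" "content f = 1" "degree f = degree f0"
    using f0 by (simp_all add: f_def)
  have "ev f0 = of_int (content f0) * ev f"
    by (metis content_times_primitive_part ev(3) f_def)
  hence evf: "ev f = 0" using f0 by simp
  have dvd: "f dvd q" if q: "ev q = 0" for q
  proof -
    define r where "r = pseudo_mod q f"
    from pseudo_mod[OF f(1), of q] obtain a s where as: "a \<noteq> 0" "smult a q = f * s + r"
      and r: "r = 0 \<or> degree r < degree f" unfolding r_def by blast
    have "ev (smult a q) = ev (f * s + r)" by (simp only: as)
    hence "ev r = 0" using q evf by (simp add: ev)
    hence "r = 0" using r min[of r] f(3) by fastforce
    thus ?thesis using as primitive_dvd_smultD[OF f(2) as(1)] by simp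
  qed
  have "degree f \<noteq> 0"
  proof
    assume "degree f = 0"
    then obtain c where "f = [:c:]" using degree_eq_zeroE by blast
    thus False using evf f(1) by (simp add: ev_def map_poly_pCons)
  qed
  thus thesis using that[of f] f dvd min h by (auto simp: ev_def)
qed

section \<open>Short multiplicative relations\<close>

text \<open>View \<open>l 0, l 1, \<dots>\<close> as edge labels of a graph on \<open>V\<close>, the label of an edge being the product
  of its ends. A walk from \<open>u\<close> to \<open>v\<close> whose edge indices increase has an alternating label product
  determined by \<open>u\<close>, \<open>v\<close> and its parity; \<open>(u, S, T)\<close> records its start and the edges entering
  with exponent \<open>1\<close> and \<open>-1\<close>.\<close>

definition alternating_walks :: "'a::idom set \<Rightarrow> (nat \<Rightarrow> 'a) \<Rightarrow> nat \<Rightarrow> nat \<Rightarrow> 'a \<Rightarrow> ('a \<times> nat set \<times> nat set) set" where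
  "alternating_walks V l L k v = {(u, S, T). u \<in> V \<and> S \<subseteq> {..<k} \<and> T \<subseteq> {..<k} \<and> S \<inter> T = {} \<and>
     card S + card T \<le> L \<and>
     (card S = card T \<and> u * prod l S = v * prod l T \<or>
      card S = card T + 1 \<and> prod l S = u * v * prod l T)}"

definition walk_length :: "'a \<times> nat set \<times> nat set \<Rightarrow> nat" where
  "walk_length = (\<lambda>(u, S, T). card S + card T)"

definition walk_weight :: "('a \<times> nat set \<times> nat set) set \<Rightarrow> real" where
  "walk_weight A = (\<Sum>z\<in>A. (1/2) ^ walk_length z)"

text \<open>Exchanging the two sets inverts all earlier exponents and leaves the newest edge with
  exponent 1. Thus the relation between labels and end points has just two shapes, one per
  parity.\<close>

definition extend_walk :: "nat \<Rightarrow> 'a \<times> nat set \<times> nat set \<Rightarrow> 'a \<times> nat set \<times> nat set" where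
  "extend_walk k = (\<lambda>(u, S, T). (u, insert k T, S))"

lemma walk_length_extend:
  assumes "z \<in> alternating_walks V l L k v"
  shows "walk_length (extend_walk k z) = Suc (walk_length z)"
proof -
  obtain u S T where z: "z = (u, S, T)" by (cases z)
  have "T \<subseteq> {..<k}" using assms by (simp add: z alternating_walks_def)
  hence "finite T" "k \<notin> T" using finite_subset by auto
  thus ?thesis by (simp add: walk_length_def extend_walk_def z)
qed

lemma extend_walk_mem:
  assumes "z \<in> alternating_walks V l L k w" "walk_length z < L" "l k = v * w"
  shows "extend_walk k z \<in> alternating_walks V l L (Suc k) v"
proof -
  obtain u S T where z: "z = (u, S, T)" by (cases z)
  from assms(1) have *: "u \<in> V" "S \<subseteq> {..<k}" "T \<subseteq> {..<k}" "S \<inter> T = {}" 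
    and cases: "card S = card T \<and> u * prod l S = w * prod l T \<or>
      card S = card T + 1 \<and> prod l S = u * w * prod l T"
    by (simp_all add: z alternating_walks_def)
  have fin: "finite T" "k \<notin> T" "k \<notin> S" using *(2,3) finite_subset by auto
  have "S \<subseteq> {..<Suc k}" "insert k T \<subseteq> {..<Suc k}" using *(2,3) by auto
  moreover have "insert k T \<inter> S = {}" using fin *(4) by auto
  moreover have "card (insert k T) + card S \<le> L"
    using assms(2) fin by (simp add: z walk_length_def)
  moreover have "card (insert k T) = card S \<and> u * prod l (insert k T) = v * prod l S \<or>
      card (insert k T) = card S + 1 \<and> prod l (insert k T) = u * v * prod l S"
    using cases fin assms(3) by (auto simp: algebra_simps)
  ultimately show ?thesis using *(1) by (simp add: z extend_walk_def alternating_walks_def)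
qed

lemma finite_alternating_walks:
  assumes "finite V"
  shows "finite (alternating_walks V l L k v)"
proof (rule finite_subset)
  show "alternating_walks V l L k v \<subseteq> V \<times> Pow {..<k} \<times> Pow {..<k}"
    by (auto simp: alternating_walks_def)
qed (use assms in auto)

lemma alternating_walks_mono: "k \<le> k' \<Longrightarrow> alternating_walks V l L k v \<subseteq> alternating_walks V l L k' v"
  by (fastforce simp: alternating_walks_def)

lemma walk_weight_mono: "A \<subseteq> A' \<Longrightarrow> finite A' \<Longrightarrow> walk_weight A \<le> walk_weight A'"
  unfolding walk_weight_def by (rule sum_mono2) auto

lemma trivial_walk_mem: "v \<in> V \<Longrightarrow> (v, {}, {}) \<in> alternating_walks V l L k v"
  by (auto simp: alternating_walks_def)

lemma one_le_walk_weight: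
  assumes "finite V" "v \<in> V"
  shows "1 \<le> walk_weight (alternating_walks V l L k v)"
proof -
  have "walk_weight {(v, {}, {})} \<le> walk_weight (alternating_walks V l L k v)"
    using assms finite_alternating_walks[OF assms(1)] trivial_walk_mem[OF assms(2)]
    by (intro walk_weight_mono) auto
  thus ?thesis by (simp add: walk_weight_def walk_length_def)
qed

text \<open>Each walk to w shorter than L extends through edge k to v at half its weight. Walks of
  full length L weigh at most 2n / 2^L <= 1/2 together, which is at most half of the weight at w
  since the trivial walk alone weighs 1. So v gains at least half of a half.\<close>

lemma walk_weight_step:
  assumes V: "finite V" "w \<in> V" and lk: "l k = v * w"
    and card: "card (alternating_walks V l L k w) \<le> 2 * n" and L: "4 * n \<le> 2 ^ L"
  shows "walk_weight (alternating_walks V l L (Suc k) v) \<ge>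
    walk_weight (alternating_walks V l L k v) + walk_weight (alternating_walks V l L k w) / 4"
proof -
  let ?A = "alternating_walks V l L"
  define E where "E = {z \<in> ?A k w. walk_length z < L}"
  have finA: "finite (?A j u)" for j u by (rule finite_alternating_walks[OF V(1)])
  have finE: "finite E" unfolding E_def using finA by simp
  have inj: "inj_on (extend_walk k) E"
  proof (rule inj_onI)
    fix y z assume yz: "y \<in> E" "z \<in> E" "extend_walk k y = extend_walk k z"
    obtain u S T u' S' T' where y: "y = (u, S, T)" "z = (u', S', T')" by (cases y, cases z)
    have "T \<subseteq> {..<k}" "T' \<subseteq> {..<k}" using yz(1,2) by (auto simp: y E_def alternating_walks_def)
    hence "k \<notin> T" "k \<notin> T'" by auto
    thus "y = z" using yz(3) by (auto simp: y extend_walk_def insert_ident)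
  qed
  have disj: "?A k v \<inter> extend_walk k ` E = {}"
    by (auto simp: alternating_walks_def extend_walk_def)
  have "walk_weight (?A k w) = walk_weight E + walk_weight (?A k w - E)"
    unfolding walk_weight_def using finA by (subst sum.subset_diff[of E]) (auto simp: E_def)
  moreover have "walk_weight (?A k w - E) \<le> 1 / 2"
  proof -
    have "walk_weight (?A k w - E) = (\<Sum>z\<in>?A k w - E. (1/2) ^ L)"
      unfolding walk_weight_def
      by (intro sum.cong) (auto simp: E_def alternating_walks_def walk_length_def)
    also have "\<dots> = real (card (?A k w - E)) * (1/2) ^ L" by simp
    also have "\<dots> \<le> real (2 * n) * (1/2) ^ L"
      using card card_mono[OF finA, of "?A k w - E" k w] by (intro mult_right_mono) auto
    also have "\<dots> \<le> 1 / 2"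
    proof -
      have "real (4 * n) \<le> 2 ^ L" using L by (metis of_nat_le_iff of_nat_numeral of_nat_power)
      thus ?thesis by (simp add: field_simps)
    qed
    finally show ?thesis .
  qed
  moreover have "1 \<le> walk_weight (?A k w)" using one_le_walk_weight V by blast
  ultimately have E: "walk_weight (?A k w) / 2 \<le> walk_weight E" by linarith
  have "walk_weight (?A k v) + walk_weight (extend_walk k ` E) = walk_weight (?A k v \<union> extend_walk k ` E)"
    unfolding walk_weight_def using finA finE disj by (subst sum.union_disjoint) auto
  also have "\<dots> \<le> walk_weight (?A (Suc k) v)"
    using finA alternating_walks_mono[of k "Suc k" V l L v] extend_walk_mem[of _ V l L k w v] lk
    by (intro walk_weight_mono) (auto simp: E_def)
  also have "walk_weight (extend_walk k ` E) = (\<Sum>z\<in>E. (1/2) ^ walk_length (extend_walk k z))"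
    unfolding walk_weight_def by (subst sum.reindex[OF inj]) simp
  also have "\<dots> = (\<Sum>z\<in>E. (1/2) ^ walk_length z / 2)"
    by (intro sum.cong) (auto simp: E_def walk_length_extend)
  also have "\<dots> = walk_weight E / 2" by (simp add: walk_weight_def sum_divide_distrib)
  finally show ?thesis using E by simp
qed

text \<open>Apply \<open>walk_weight_step\<close> at the lighter end v of the edge: it gains a
  quarter of the weight at the heavier end, hence at least a quarter of its own, and no other weight
  decreases.\<close>

lemma walk_weight_product_step:
  assumes V: "finite V" "f \<in> V" "g \<in> V" and lk: "l k = f * g"
    and card: "\<And>w. w \<in> V \<Longrightarrow> card (alternating_walks V l L k w) \<le> 2 * n" and L: "4 * n \<le> 2 ^ L"
  shows "(\<Prod>v\<in>V. walk_weight (alternating_walks V l L (Suc k) v)) \<ge>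
    5 / 4 * (\<Prod>v\<in>V. walk_weight (alternating_walks V l L k v))"
proof -
  define X where "X = (\<lambda>k v. walk_weight (alternating_walks V l L k v))"
  obtain v w where vw: "v \<in> V" "w \<in> V" "l k = v * w" "X k v \<le> X k w"
    using V lk by (metis linear mult.commute)
  have pos: "X k u \<ge> 1" if "u \<in> V" for k u
    unfolding X_def by (rule one_le_walk_weight[OF V(1) that])
  have "X (Suc k) v \<ge> X k v + X k w / 4" unfolding X_def
    by (rule walk_weight_step) (use V vw card L in auto)
  hence v: "X (Suc k) v \<ge> 5 / 4 * X k v" using vw(4) by linarith
  have "5 / 4 * (\<Prod>v\<in>V. X k v) = (5 / 4 * X k v) * (\<Prod>u\<in>V - {v}. X k u)"
    using vw V by (simp add: prod.remove[of V v])
  also have "\<dots> \<le> X (Suc k) v * (\<Prod>u\<in>V - {v}. X (Suc k) u)"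
  proof (intro mult_mono v prod_mono conjI)
    fix u assume u: "u \<in> V - {v}"
    show "X k u \<le> X (Suc k) u" unfolding X_def
      by (intro walk_weight_mono alternating_walks_mono finite_alternating_walks V(1)) simp
    show "0 \<le> X k u" using pos[of u k] u by simp
  next
    show "0 \<le> X (Suc k) v" using pos[of v] vw(1) by (meson order_trans zero_le_one)
    show "0 \<le> (\<Prod>u\<in>V - {v}. X k u)"
      by (intro prod_nonneg ballI) (use pos in \<open>meson DiffD1 order_trans zero_le_one\<close>)
  qed
  also have "\<dots> = (\<Prod>v\<in>V. X (Suc k) v)" using vw V by (simp add: prod.remove[of V v])
  finally show ?thesis by (simp add: X_def)
qed

text \<open>If distinct short walks never collide, every end point sees at most \<open>2 * card V\<close> of them, while
  the product over \<open>v\<close> of the walk counts, discounted by \<open>1/2\<close> per edge,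
  grows by a factor \<open>5/4\<close> with each edge.\<close>

lemma exists_short_multiplicative_relation:
  fixes V :: "'a::idom set" and l f g :: "nat \<Rightarrow> 'a"
  assumes V: "finite V" "0 \<notin> V"
    and fg: "\<And>k. k < N \<Longrightarrow> f k \<in> V" "\<And>k. k < N \<Longrightarrow> g k \<in> V" "\<And>k. k < N \<Longrightarrow> l k = f k * g k"
    and N: "real (2 * card V) ^ card V < (5 / 4) ^ N" and L: "4 * card V \<le> 2 ^ L"
  obtains S T S' T' where "S \<subseteq> {..<N}" "T \<subseteq> {..<N}" "S' \<subseteq> {..<N}" "T' \<subseteq> {..<N}"
    "S \<inter> T = {}" "S' \<inter> T' = {}" "(S, T) \<noteq> (S', T')"
    "card S + card T \<le> L" "card S' + card T' \<le> L" "card S + card T' = card S' + card T"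
    "prod l S * prod l T' = prod l S' * prod l T"
proof -
  let ?A = "alternating_walks V l L"
  \<comment> \<open>The key consists of start and parity, so it takes at most
    \<open>2 * card V\<close> values. Two walks with the same end and the same key give the
    relation.\<close>
  let ?key = "\<lambda>(u, S, T). (u, card S = card T)"
  have finA: "finite (?A j u)" for j u by (rule finite_alternating_walks[OF V(1)])
  have "\<exists>v\<in>V. \<not> inj_on ?key (?A N v)"
  proof (rule ccontr)
    assume "\<not> ?thesis"
    hence inj: "inj_on ?key (?A N v)" if "v \<in> V" for v using that by blast
    have card: "card (?A k v) \<le> 2 * card V" if "v \<in> V" "k \<le> N" for k v
    proof -
      have "card (?A k v) \<le> card (?A N v)"
        by (intro card_mono finA alternating_walks_mono that)
      also have "\<dots> = card (?key ` ?A N v)" by (rule card_image [symmetric, OF inj[OF that(1)]])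
      also have "\<dots> \<le> card (V \<times> (UNIV :: bool set))"
        using V(1) by (intro card_mono) (auto simp: alternating_walks_def)
      finally show ?thesis by (simp add: card_cartesian_product mult.commute)
    qed
    have "(5 / 4) ^ k \<le> (\<Prod>v\<in>V. walk_weight (?A k v))" if "k \<le> N" for k
      using that
    proof (induction k)
      case 0
      have "1 \<le> (\<Prod>v\<in>V. walk_weight (?A 0 v))"
        by (intro prod_ge_1 one_le_walk_weight V(1))
      thus ?case by simp
    next
      case (Suc k)
      have "(\<Prod>v\<in>V. walk_weight (?A (Suc k) v)) \<ge> 5 / 4 * (\<Prod>v\<in>V. walk_weight (?A k v))"
        using Suc.prems by (intro walk_weight_product_step[where f = "f k" and g = "g k" and n = "card V"] V fg card L) auto
      thus ?case using Suc by simp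
    qed
    hence "(5 / 4) ^ N \<le> (\<Prod>v\<in>V. walk_weight (?A N v))" by simp
    also have "\<dots> \<le> (\<Prod>v\<in>V. real (2 * card V))"
    proof (rule prod_mono)
      fix v assume v: "v \<in> V"
      have "walk_weight (?A N v) \<le> (\<Sum>z\<in>?A N v. 1)"
        unfolding walk_weight_def by (intro sum_mono power_le_one) auto
      also have "\<dots> \<le> real (2 * card V)" using card[OF v, of N] by simp
      finally show "0 \<le> walk_weight (?A N v) \<and> walk_weight (?A N v) \<le> real (2 * card V)"
        using one_le_walk_weight[OF V(1) v, of l L N] by linarith
    qed
    finally show False using N by simp
  qed
  then obtain v y z where v: "v \<in> V" and yz: "y \<in> ?A N v" "z \<in> ?A N v" "?key y = ?key z" "y \<noteq> z"
    unfolding inj_on_def by blast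
  obtain u S T u' S' T' where y: "y = (u, S, T)" "z = (u', S', T')" by (cases y, cases z)
  have u: "u' = u" "u \<in> V" and par: "(card S = card T) = (card S' = card T')"
    using yz by (auto simp: y alternating_walks_def)
  have uv: "u * v \<noteq> 0" using u v V by auto
  from yz(1,2) have
    1: "card S = card T \<and> u * prod l S = v * prod l T \<or> card S = card T + 1 \<and> prod l S = u * v * prod l T"
    and 2: "card S' = card T' \<and> u * prod l S' = v * prod l T' \<or> card S' = card T' + 1 \<and> prod l S' = u * v * prod l T'"
    by (simp_all add: y alternating_walks_def u)
  \<comment> \<open>For even walks, multiply one relation by the other crosswise; for odd walks both
    sides become (u v)^2 times the same product. The factor u v is nonzero because 0 is not in
    V.\<close>
  have "(u * v) * (prod l S * prod l T') = (u * v) * (prod l S' * prod l T)"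
    using 1 2 par
  proof (elim disjE conjE)
    assume "u * prod l S = v * prod l T" "u * prod l S' = v * prod l T'"
    hence "(u * prod l S) * (v * prod l T') = (u * prod l S') * (v * prod l T)" by (simp add: mult.commute)
    thus ?thesis by (simp add: ac_simps)
  qed (auto simp: algebra_simps)
  hence "prod l S * prod l T' = prod l S' * prod l T" using uv by (metis mult_left_cancel)
  moreover have "card S + card T' = card S' + card T" using 1 2 par by auto
  moreover have "S \<subseteq> {..<N}" "T \<subseteq> {..<N}" "S' \<subseteq> {..<N}" "T' \<subseteq> {..<N}"
    "S \<inter> T = {}" "S' \<inter> T' = {}" "(S, T) \<noteq> (S', T')" "card S + card T \<le> L" "card S' + card T' \<le> L"
    using yz by (auto simp: y u alternating_walks_def)
  ultimately show thesis by (intro that)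
qed

section \<open>From multiplicative relations to polynomials\<close>

text \<open>The factors are k - x and not x - k, so that evaluation at \<open>\<rho>\<close> matches
  the labels \<open>d * (of_nat k - \<rho>)\<close> without signs.\<close>

definition linear_factors :: "nat set \<Rightarrow> int poly" where
  "linear_factors S = (\<Prod>k\<in>S. [:int k, -1:])"

lemma poly_linear_factors: "poly (linear_factors S) x = (\<Prod>k\<in>S. int k - x)"
  by (simp add: linear_factors_def poly_prod)

lemma poly_of_int_linear_factors:
  "poly (map_poly of_int (linear_factors S)) x = (\<Prod>k\<in>S. of_nat k - (x :: 'a::comm_ring_1))"
proof (induction S rule: infinite_finite_induct)
  case (insert k S)
  thus ?case by (simp add: linear_factors_def map_poly_of_int_mult map_poly_pCons del: mult_pCons_left)
qed (auto simp: linear_factors_def)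

lemma degree_linear_factors_le: "finite S \<Longrightarrow> degree (linear_factors S) \<le> card S"
  using degree_prod_sum_le[of S "\<lambda>k. [:int k, -1:]"] by (simp add: linear_factors_def)

lemma poly_linear_factors_eq_0_iff:
  "finite S \<Longrightarrow> poly (linear_factors S) (int k) = 0 \<longleftrightarrow> k \<in> S"
  by (auto simp: poly_linear_factors)

text \<open>Comparing roots gives S \<union> T' = S' \<union> T, and disjointness separates the two
  parts.\<close>

lemma linear_factors_cross_eqD:
  assumes fin: "finite S" "finite T" "finite S'" "finite T'" and disj: "S \<inter> T = {}" "S' \<inter> T' = {}"
    and eq: "linear_factors S * linear_factors T' = linear_factors S' * linear_factors T"
  shows "S = S' \<and> T = T'"
proof -
  have "poly (linear_factors S * linear_factors T') (int k) = 0 \<longleftrightarrow>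
      poly (linear_factors S' * linear_factors T) (int k) = 0" for k
    by (rule arg_cong[OF eq])
  hence "k \<in> S \<or> k \<in> T' \<longleftrightarrow> k \<in> S' \<or> k \<in> T" for k
    using fin by (simp add: poly_linear_factors_eq_0_iff)
  thus ?thesis using disj by blast
qed

text \<open>A short relation between labels has as many factors on either side, so the powers of
  \<open>d\<close> cancel and \<open>\<rho>\<close> is a root of a difference of products of linear
  factors. The difference is nonzero because the two walks are distinct.\<close>

lemma exists_low_degree_poly:
  fixes B :: "complex set"
  assumes B: "finite B" and d: "d \<noteq> 0"
    and AP: "\<And>k. k < N \<Longrightarrow> d * (of_nat k - \<rho>) \<in> {b * b' | b b'. b \<in> B \<and> b' \<in> B}"
    and N: "real (2 * card B) ^ card B < (5 / 4) ^ N" and L: "4 * card B \<le> 2 ^ L"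
  obtains h :: "int poly" where "h \<noteq> 0" "degree h \<le> 2 * L" "poly (map_poly of_int h) \<rho> = 0"
proof -
  \<comment> \<open>If B is empty, the left side of the hypothesis on N is 0^0 = 1, so N = 0 is
    ruled out in this case too.\<close>
  have "1 \<le> real (2 * card B) ^ card B" 
    by (cases "card B = 0") (simp, rule one_le_power, linarith)
  hence N0: "N > 0" using N by (cases "N = 0") auto
  have "B \<noteq> {}" using AP[OF N0] by blast
  hence B0: "card B > 0" using B by (simp add: card_gt_0_iff)
  show thesis
  proof (cases "\<exists>k<N. \<rho> = of_nat k")
    case True
    then obtain k where k: "\<rho> = of_nat k" by blast
    have "L \<noteq> 0" using L B0 by (cases "L = 0") auto
    thus thesis using that[of "[:- int k, 1:]"] by (simp add: k map_poly_pCons)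
  next
    case False
    \<comment> \<open>No label vanishes in this case, so none uses the vertex 0, and the end points
      can be cancelled in V.\<close>
    define V where "V = B - {0}"
    have V: "finite V" "0 \<notin> V" "card V \<le> card B" 
      using B by (auto simp: V_def intro: card_mono)
    define l where "l = (\<lambda>k. d * (of_nat k - \<rho>))"
    have "\<exists>b b'. b \<in> V \<and> b' \<in> V \<and> l k = b * b'" if "k < N" for k
    proof -
      have "l k \<noteq> 0" using that False d by (auto simp: l_def)
      moreover obtain b b' where "b \<in> B" "b' \<in> B" "l k = b * b'"
        using AP[OF \<open>k < N\<close>] by (auto simp: l_def)
      ultimately show ?thesis by (intro exI[of _ b] exI[of _ b']) (auto simp: V_def)
    qed
    then obtain f g where fg: "\<And>k. k < N \<Longrightarrow> f k \<in> V" "\<And>k. k < N \<Longrightarrow> g k \<in> V"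
      "\<And>k. k < N \<Longrightarrow> l k = f k * g k" by metis
    have "real (2 * card V) ^ card V \<le> real (2 * card B) ^ card V"
      using V by (intro power_mono) auto
    also have "\<dots> \<le> real (2 * card B) ^ card B"
      using V B0 by (intro power_increasing) auto
    finally have N': "real (2 * card V) ^ card V < (5 / 4) ^ N" using N by simp
    have L': "4 * card V \<le> 2 ^ L" using L V by linarith
    obtain S T S' T' where *: "S \<subseteq> {..<N}" "T \<subseteq> {..<N}" "S' \<subseteq> {..<N}" "T' \<subseteq> {..<N}"
      "S \<inter> T = {}" "S' \<inter> T' = {}" "(S, T) \<noteq> (S', T')"
      "card S + card T \<le> L" "card S' + card T' \<le> L" "card S + card T' = card S' + card T"
      "prod l S * prod l T' = prod l S' * prod l T"
      by (rule exists_short_multiplicative_relation[OF V(1,2) fg N' L'])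
    have fin: "finite S" "finite T" "finite S'" "finite T'" using *(1-4) by (auto intro: finite_subset)
    define h where "h = linear_factors S * linear_factors T' - linear_factors S' * linear_factors T"
    have "h \<noteq> 0"
      using linear_factors_cross_eqD[OF fin *(5,6)] *(7) by (auto simp: h_def)
    moreover have "degree h \<le> 2 * L"
      unfolding h_def
    proof (rule degree_diff_le)
      show "degree (linear_factors S * linear_factors T') \<le> 2 * L"
        using degree_mult_le[of "linear_factors S" "linear_factors T'"]
          degree_linear_factors_le[OF fin(1)] degree_linear_factors_le[OF fin(4)] *(8-10) by linarith
      show "degree (linear_factors S' * linear_factors T) \<le> 2 * L"
        using degree_mult_le[of "linear_factors S'" "linear_factors T"]
          degree_linear_factors_le[OF fin(3)] degree_linear_factors_le[OF fin(2)] *(8-10) by linarith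
    qed
    moreover have "poly (map_poly of_int h) \<rho> = 0"
    proof -
      define P where "P = (\<lambda>S. \<Prod>k\<in>S. of_nat k - \<rho>)"
      have l: "prod l S = d ^ card S * P S" for S by (simp add: l_def P_def prod.distrib)
      have h: "h + linear_factors S' * linear_factors T = linear_factors S * linear_factors T'"
        by (simp add: h_def)
      have "poly (map_poly of_int h) \<rho> + P S' * P T = P S * P T'"
        using arg_cong[OF h, of "\<lambda>q. poly (map_poly of_int q) \<rho>"]
        by (simp add: map_poly_of_int_add map_poly_of_int_mult poly_of_int_linear_factors P_def)
      moreover have "d ^ (card S + card T') * (P S * P T') = d ^ (card S' + card T) * (P S' * P T)"
        using *(11) by (simp add: l power_add ac_simps)
      hence "P S * P T' = P S' * P T" using d *(10) by simp
      ultimately show ?thesis by simp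
    qed
    ultimately show thesis by (rule that)
  qed
qed

section \<open>Triangular subsets and relations among equally many labels\<close>

lemma exists_large_isolated_subset:
  assumes "finite R" "\<And>k. k \<in> R \<Longrightarrow> P k k" "\<And>k. k \<in> R \<Longrightarrow> card {l \<in> R. P k l} \<le> h"
  shows "\<exists>A\<subseteq>R. card R \<le> h * card A \<and>
    (\<forall>A'\<subseteq>A. A' \<noteq> {} \<longrightarrow> (\<exists>k\<in>A'. \<forall>l\<in>A'. l \<noteq> k \<longrightarrow> \<not> P k l))"
  using assms
proof (induction R rule: finite_psubset_induct)
  case (psubset R)
  show ?case
  proof (cases "R = {}")
    case False
    then obtain k where k: "k \<in> R" by blast
    \<comment> \<open>Greedy choice: keep k and discard the at most h elements related to it, k
      itself among them. In any subset of the chosen elements, the one chosen first is related to no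
      other.\<close>
    define R1 where "R1 = {l \<in> R. \<not> P k l}"
    have R1: "R1 \<subset> R" using k psubset.prems(1) by (auto simp: R1_def)
    have "card {l \<in> R1. P j l} \<le> h" if "j \<in> R1" for j
    proof -
      have "card {l \<in> R1. P j l} \<le> card {l \<in> R. P j l}"
        using psubset.hyps R1 by (intro card_mono) auto
      thus ?thesis using psubset.prems(2)[of j] that R1 by auto
    qed
    with psubset.IH[OF R1] psubset.prems(1) R1 obtain A where A: "A \<subseteq> R1" "card R1 \<le> h * card A"
      "\<And>A'. A' \<subseteq> A \<Longrightarrow> A' \<noteq> {} \<Longrightarrow> \<exists>k\<in>A'. \<forall>l\<in>A'. l \<noteq> k \<longrightarrow> \<not> P k l"
      by blast
    have finA: "finite A" using A(1) R1 psubset.hyps by (meson finite_subset psubset_imp_subset)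
    have kA: "k \<notin> A" using A(1) k psubset.prems(1) by (auto simp: R1_def)
    have "card R = card {l \<in> R. P k l} + card R1"
      using psubset.hyps unfolding R1_def by (subst card_Un_disjoint [symmetric]) (auto intro: arg_cong[where f = card])
    also have "\<dots> \<le> h + h * card A" using psubset.prems(2)[OF k] A(2) by linarith
    finally have "card R \<le> h * card (insert k A)" using finA kA by simp
    moreover have "\<exists>j\<in>A'. \<forall>l\<in>A'. l \<noteq> j \<longrightarrow> \<not> P j l" if A': "A' \<subseteq> insert k A" "A' \<noteq> {}" for A'
    proof (cases "k \<in> A'")
      case True
      have "\<forall>l\<in>A'. l \<noteq> k \<longrightarrow> \<not> P k l" using A' A(1) by (auto simp: R1_def)
      with True show ?thesis by blast
    next
      case False
      thus ?thesis using A' A(3)[of A'] by blast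
    qed
    moreover have "insert k A \<subseteq> R" using A(1) R1 k by blast
    ultimately show ?thesis by blast
  qed auto
qed

lemma prod_fibres:
  assumes "finite S" "finite B" "f ` S \<subseteq> B"
  shows "(\<Prod>k\<in>S. f k) = (\<Prod>b\<in>B. (b :: 'a::comm_monoid_mult) ^ card {k \<in> S. f k = b})"
proof -
  have "(\<Prod>k\<in>S. f k) = (\<Prod>b\<in>B. \<Prod>k\<in>{k \<in> S. f k = b}. f k)"
    using prod.group[OF assms, of f] by (rule sym)
  also have "\<dots> = (\<Prod>b\<in>B. b ^ card {k \<in> S. f k = b})"
    by (intro prod.cong refl) simp
  finally show ?thesis .
qed

text \<open>Pigeonhole on the exponent vectors over \<open>B\<close>, whose entries are at most
  \<open>2 * card A\<close>. The entries of the vector of S sum to \<open>2 * card S\<close>, so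
  equal vectors also force equal cardinalities.\<close>

lemma exists_equal_subset_products:
  fixes f g :: "'b \<Rightarrow> 'a::comm_monoid_mult"
  assumes A: "finite A" and B: "finite B" and fg: "f ` A \<subseteq> B" "g ` A \<subseteq> B"
    and card: "(2 * card A + 1) ^ card B < 2 ^ card A"
  obtains S S' where "S \<subseteq> A" "S' \<subseteq> A" "S \<noteq> S'" "card S = card S'"
    "(\<Prod>k\<in>S. f k * g k) = (\<Prod>k\<in>S'. f k * g k)"
proof -
  define c where "c = (\<lambda>S. \<lambda>b\<in>B. card {k \<in> S. f k = b} + card {k \<in> S. g k = b})"
  have cardS: "card {k \<in> S. P k} \<le> card A" if "S \<subseteq> A" for S P
    using A that by (intro card_mono) auto
  have "c ` Pow A \<subseteq> (\<Pi>\<^sub>E b\<in>B. {..2 * card A})"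
    using cardS by (force simp: c_def mult_2 intro: add_mono)
  hence "card (c ` Pow A) \<le> card (\<Pi>\<^sub>E b\<in>B. {..2 * card A})"
    using B by (intro card_mono finite_PiE) auto
  also have "\<dots> = (2 * card A + 1) ^ card B" using B by (simp add: card_PiE)
  also have "\<dots> < card (Pow A)" using card A by (simp add: card_Pow)
  finally obtain S S' where S: "S \<subseteq> A" "S' \<subseteq> A" "S \<noteq> S'" "c S = c S'"
    using pigeonhole[of c "Pow A"] unfolding inj_on_def by blast
  have prod: "(\<Prod>k\<in>S. f k * g k) = (\<Prod>b\<in>B. b ^ c S b)"
    and sum: "2 * card S = (\<Sum>b\<in>B. c S b)" if "S \<subseteq> A" for S
  proof -
    have fin: "finite S" "f ` S \<subseteq> B" "g ` S \<subseteq> B" using that A fg finite_subset by blast+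
    show "(\<Prod>k\<in>S. f k * g k) = (\<Prod>b\<in>B. b ^ c S b)"
      using prod_fibres[OF fin(1) B fin(2)] prod_fibres[OF fin(1) B fin(3)]
      by (simp add: c_def power_add prod.distrib)
    have "card S = (\<Sum>b\<in>B. card {k \<in> S. f k = b})" "card S = (\<Sum>b\<in>B. card {k \<in> S. g k = b})"
      using sum.group[OF fin(1) B fin(2), of "\<lambda>_. 1::nat"] sum.group[OF fin(1) B fin(3), of "\<lambda>_. 1::nat"]
      by simp_all
    thus "2 * card S = (\<Sum>b\<in>B. c S b)" by (simp add: c_def sum.distrib)
  qed
  show thesis
    using that[OF S(1-3)] prod[OF S(1)] prod[OF S(2)] sum[OF S(1)] sum[OF S(2)] S(4) by simp
qed

text \<open>Two subsets of \<open>A\<close> with equal label products give a polynomial relation between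
  \<open>linear_factors\<close>, hence a congruence modulo \<open>p k\<close> at \<open>k\<close>, where exactly one side vanishes
  if \<open>k\<close> is isolated.\<close>

lemma isolated_primes_bound:
  fixes B :: "complex set" and A :: "nat set" and p :: "nat \<Rightarrow> nat"
  assumes B: "finite B" and A: "finite A" and d: "d \<noteq> 0"
    and AP: "\<And>k. k \<in> A \<Longrightarrow> d * (of_nat k - \<rho>) \<in> {b * b' | b b'. b \<in> B \<and> b' \<in> B}"
    and f: "\<And>q. poly (map_poly of_int q) \<rho> = 0 \<Longrightarrow> f dvd q"
    and p: "\<And>k. k \<in> A \<Longrightarrow> prime (p k)" "\<And>k. k \<in> A \<Longrightarrow> int (p k) dvd poly f (int k)"
    and nz: "\<And>k. k \<in> A \<Longrightarrow> of_nat k \<noteq> \<rho>"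
    and iso: "\<And>A'. A' \<subseteq> A \<Longrightarrow> A' \<noteq> {} \<Longrightarrow>
      \<exists>k\<in>A'. \<forall>l\<in>A'. l \<noteq> k \<longrightarrow> \<not> int (p k) dvd int l - int k"
  shows "2 ^ card A \<le> (2 * card A + 1) ^ card B"
proof (rule ccontr)
  assume "\<not> ?thesis"
  hence card: "(2 * card A + 1) ^ card B < 2 ^ card A" by simp
  have "\<exists>b b'. b \<in> B \<and> b' \<in> B \<and> d * (of_nat k - \<rho>) = b * b'" if "k \<in> A" for k
    using AP[OF that] by blast
  then obtain u v where uv: "\<And>k. k \<in> A \<Longrightarrow> u k \<in> B" "\<And>k. k \<in> A \<Longrightarrow> v k \<in> B"
    "\<And>k. k \<in> A \<Longrightarrow> d * (of_nat k - \<rho>) = u k * v k" by metis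
  obtain S S' where S: "S \<subseteq> A" "S' \<subseteq> A" "S \<noteq> S'" "card S = card S'"
    "(\<Prod>k\<in>S. u k * v k) = (\<Prod>k\<in>S'. u k * v k)"
    using exists_equal_subset_products[OF A B _ _ card, of u v] uv(1,2) by blast
  have fin: "finite S" "finite S'" using S A finite_subset by blast+
  define P where "P = (\<lambda>S. \<Prod>k\<in>S. of_nat k - \<rho>)"
  have l: "(\<Prod>k\<in>U. u k * v k) = d ^ card U * P U" if "U \<subseteq> A" for U
  proof -
    have "(\<Prod>k\<in>U. u k * v k) = (\<Prod>k\<in>U. d * (of_nat k - \<rho>))"
      using uv(3) that by (intro prod.cong) auto
    thus ?thesis by (simp add: P_def prod.distrib)
  qed
  have "P S = P S'" using S(4,5) l[OF S(1)] l[OF S(2)] d by simp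
  \<comment> \<open>Cancelling the common factors, nonzero by \<open>nz\<close>, makes the two sides
    disjoint. The isolated k then lies on exactly one side.\<close>
  moreover have "P S = P (S - S') * P (S \<inter> S')" "P S' = P (S' - S) * P (S \<inter> S')"
    unfolding P_def using fin
    by (subst prod.union_disjoint [symmetric]; auto intro!: prod.cong)+
  moreover have "P (S \<inter> S') \<noteq> 0" unfolding P_def using fin nz S(1) by (auto simp: prod_zero_iff)
  ultimately have P: "P (S - S') = P (S' - S)" by simp
  define h where "h = linear_factors (S - S') - linear_factors (S' - S)"
  have h: "h + linear_factors (S' - S) = linear_factors (S - S')" by (simp add: h_def)
  have "poly (map_poly of_int h) \<rho> = 0"
    using arg_cong[OF h, of "\<lambda>q. poly (map_poly of_int q) \<rho>"] P
    by (simp add: map_poly_of_int_add poly_of_int_linear_factors P_def)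
  from f[OF this] obtain q where q: "h = f * q" by (elim dvdE)
  obtain k where k: "k \<in> (S - S') \<union> (S' - S)"
    "\<And>l. l \<in> (S - S') \<union> (S' - S) \<Longrightarrow> l \<noteq> k \<Longrightarrow> \<not> int (p k) dvd int l - int k"
    using iso[of "(S - S') \<union> (S' - S)"] S(1-3) by blast
  have kA: "k \<in> A" using k(1) S(1,2) by blast
  have pk: "prime (int (p k))" using p(1)[OF kA] by simp
  have "int (p k) dvd poly h (int k)" using p(2)[OF kA] by (simp add: q)
  hence dvd: "int (p k) dvd poly (linear_factors (S - S')) (int k) - poly (linear_factors (S' - S)) (int k)"
    by (simp add: h_def)
  have not_dvd: "\<not> int (p k) dvd poly (linear_factors U) (int k)"
    if "U \<subseteq> (S - S') \<union> (S' - S)" "k \<notin> U" for U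
  proof -
    have "finite U" using that(1) fin by (auto intro: finite_subset)
    moreover have "\<not> int (p k) dvd int l - int k" if "l \<in> U" for l
      using k(2)[of l] that \<open>U \<subseteq> _\<close> \<open>k \<notin> U\<close> by blast
    ultimately show ?thesis using pk by (simp add: poly_linear_factors prime_dvd_prod_iff)
  qed
  have zero: "poly (linear_factors U) (int k) = 0" if "k \<in> U" "finite U" for U
    using that by (simp add: poly_linear_factors_eq_0_iff)
  from k(1) show False
  proof
    assume *: "k \<in> S - S'"
    with dvd zero[OF *] fin have "int (p k) dvd poly (linear_factors (S' - S)) (int k)" by simp
    thus False using * not_dvd[of "S' - S"] by blast
  next
    assume *: "k \<in> S' - S"
    with dvd zero[OF *] fin have "int (p k) dvd poly (linear_factors (S - S')) (int k)" by simp
    thus False using * not_dvd[of "S - S'"] by blast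
  qed
qed

section \<open>Large prime factors of polynomial values\<close>

lemma multiplicity_of_nat_int: "multiplicity (int p) (int m) = multiplicity p m"
proof -
  have "int p ^ j dvd int m \<longleftrightarrow> p ^ j dvd m" for j
    by (metis int_dvd_int_iff of_nat_power)
  thus ?thesis by (simp add: multiplicity_def)
qed

lemma multiplicity_nat_abs: "multiplicity p (nat \<bar>x\<bar>) = multiplicity (int p) x"
  by (metis abs_ge_zero int_nat_eq multiplicity_normalize_right multiplicity_of_nat_int normalize_int_def)

lemma multiplicity_prod_list:
  fixes xs :: "int list"
  assumes "prime p" "0 \<notin> set xs"
  shows "multiplicity p (prod_list xs) = (\<Sum>x\<leftarrow>xs. multiplicity p x)"
  using assms(2)
proof (induction xs)
  case (Cons x xs)
  hence "x \<noteq> 0" "prod_list xs \<noteq> 0" by (auto simp: prod_list_zero_iff)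
  moreover have "prime_elem p" using assms(1) by (rule prime_imp_prime_elem)
  ultimately show ?case using Cons by (simp add: prime_elem_multiplicity_mult_distrib)
qed simp

text \<open>The distances from j to the points on its left and right run through 1..j and 1..N - 1 -
  j; Legendre's bound applies to each range.\<close>

lemma sum_multiplicity_shift_le:
  fixes p :: nat
  assumes p: "prime p" and j: "j < N" and T: "T \<subseteq> {..<N} - {j}"
  shows "(p - 1) * (\<Sum>k\<in>T. multiplicity (int p) (int k - int j)) \<le> N"
proof -
  let ?m = "\<lambda>k. multiplicity (int p) (int k - int j)"
  have "(\<Sum>k\<in>T. ?m k) \<le> (\<Sum>k\<in>{..<j} \<union> {j<..<N}. ?m k)"
    using T by (intro sum_mono2) auto
  also have "\<dots> = (\<Sum>k<j. ?m k) + (\<Sum>k\<in>{j<..<N}. ?m k)"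
    by (rule sum.union_disjoint) auto
  also have "(\<Sum>k<j. ?m k) = (\<Sum>i=1..j. multiplicity p i)"
  proof (rule sum.reindex_bij_witness[of _ "\<lambda>i. j - i" "\<lambda>k. j - k"])
    fix k assume "k \<in> {..<j}"
    hence "int k - int j = - int (j - k)" by auto
    hence "?m k = multiplicity (int p) (int (j - k))"
      by (simp only: multiplicity_nat_abs [symmetric] abs_minus_cancel)
    thus "multiplicity p (j - k) = ?m k" by (simp only: multiplicity_of_nat_int)
  qed auto
  also have "(\<Sum>k\<in>{j<..<N}. ?m k) = (\<Sum>i=1..N - 1 - j. multiplicity p i)"
  proof (rule sum.reindex_bij_witness[of _ "\<lambda>i. j + i" "\<lambda>k. k - j"])
    fix k assume "k \<in> {j<..<N}"
    hence "int k - int j = int (k - j)" by auto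
    thus "multiplicity p (k - j) = ?m k" by (simp only: multiplicity_of_nat_int)
  qed auto
  finally have "(p - 1) * (\<Sum>k\<in>T. ?m k) \<le> 
      (p - 1) * (\<Sum>i=1..j. multiplicity p i) + (p - 1) * (\<Sum>i=1..N - 1 - j. multiplicity p i)"
    by (metis add_mult_distrib2 mult_le_mono2)
  also have "\<dots> \<le> j + (N - 1 - j)" by (intro add_mono sum_multiplicity_le p)
  finally show ?thesis using j by linarith
qed

text \<open>A primitive f is not divisible by \<open>p\<close>, so the \<open>p\<close>-part of f k
  is bounded by that of at most D differences k - e. The points e form E: away from them no
  difference vanishes, and each e contributes at most N / (p - 1) in total.\<close>

lemma sum_multiplicity_poly_le:
  fixes f :: "int poly"
  assumes p: "prime (p :: nat)" and f: "content f = 1" "degree f \<le> D"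
  obtains E where "finite E" "card E \<le> D" "\<And>T. T \<subseteq> {..<N} - E \<Longrightarrow> (\<And>k. k \<in> T \<Longrightarrow> poly f (int k) \<noteq> 0) \<Longrightarrow>
    (p - 1) * (\<Sum>k\<in>T. multiplicity p (nat \<bar>poly f (int k)\<bar>)) \<le> D * N"
proof -
  have pp: "prime (int p)" using p by simp
  have "\<not> [:int p:] dvd f"
    using f(1) not_prime_unit[of "int p"] pp by (auto simp: const_poly_dvd_iff_dvd_content)
  from prime_power_dvd_poly_bound[OF pp this f(2), of "int ` {..<N}"] obtain es where es:
    "length es \<le> D" "set es \<subseteq> int ` {..<N}"
    "\<And>k t. k < N \<Longrightarrow> int p ^ t dvd poly f (int k) \<Longrightarrow> int p ^ t dvd (\<Prod>e\<leftarrow>es. int k - e)" by blast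
  show thesis
  proof (rule that[of "nat ` set es"])
    have "card (nat ` set es) \<le> card (set es)" by (rule card_image_le) simp
    also have "\<dots> \<le> D" using card_length[of es] es(1) by linarith
    finally show "card (nat ` set es) \<le> D" .
  next
    fix T assume T: "T \<subseteq> {..<N} - nat ` set es" "\<And>k. k \<in> T \<Longrightarrow> poly f (int k) \<noteq> 0"
    have notin: "int k \<notin> set es" if "k \<in> T" for k using T(1) that by force
    have "multiplicity p (nat \<bar>poly f (int k)\<bar>) \<le> (\<Sum>e\<leftarrow>es. multiplicity (int p) (int k - e))"
      if k: "k \<in> T" for k
    proof -
      have 0: "0 \<notin> set (map (\<lambda>e. int k - e) es)" using notin[OF k] by auto
      have "int p ^ multiplicity (int p) (poly f (int k)) dvd (\<Prod>e\<leftarrow>es. int k - e)"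
        using k T(1) by (intro es(3) multiplicity_dvd) auto
      moreover have "(\<Prod>e\<leftarrow>es. int k - e) \<noteq> 0" using 0 by (simp add: prod_list_zero_iff)
      ultimately have "multiplicity (int p) (poly f (int k)) \<le> multiplicity (int p) (\<Prod>e\<leftarrow>es. int k - e)"
        using pp by (intro multiplicity_geI) auto
      also have "\<dots> = (\<Sum>e\<leftarrow>es. multiplicity (int p) (int k - e))"
        using multiplicity_prod_list[OF pp 0] by (simp add: o_def)
      finally show ?thesis by (simp add: multiplicity_nat_abs)
    qed
    hence "(p - 1) * (\<Sum>k\<in>T. multiplicity p (nat \<bar>poly f (int k)\<bar>)) \<le>
        (p - 1) * (\<Sum>k\<in>T. \<Sum>e\<leftarrow>es. multiplicity (int p) (int k - e))"
      by (intro mult_left_mono sum_mono) auto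
    also have "\<dots> = (\<Sum>e\<leftarrow>es. (p - 1) * (\<Sum>k\<in>T. multiplicity (int p) (int k - e)))"
      by (induction es) (simp_all add: sum.distrib distrib_left)
    also have "\<dots> \<le> (\<Sum>e\<leftarrow>es. N)"
    proof (rule sum_list_mono)
      fix e assume e: "e \<in> set es"
      then obtain j where j: "e = int j" "j < N" using es(2) by auto
      have "T \<subseteq> {..<N} - {j}" using T(1) notin e j by auto
      from sum_multiplicity_shift_le[OF p j(2) this]
      show "(p - 1) * (\<Sum>k\<in>T. multiplicity (int p) (int k - e)) \<le> N" by (simp add: j)
    qed
    also have "\<dots> \<le> D * N" using es(1) by (simp add: sum_list_triv)
    finally show "(p - 1) * (\<Sum>k\<in>T. multiplicity p (nat \<bar>poly f (int k)\<bar>)) \<le> D * N" .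
  qed simp
qed

text \<open>E collects the integers within distance Y of one of the D points of
  \<open>abs_poly_lower_bound\<close>. Outside E the product of distances is at least Y^D, and the
  loss 2^D turns Y into Y / 2.\<close>

lemma ln_abs_poly_lower_bound:
  fixes f :: "int poly"
  assumes f: "f \<noteq> 0" "degree f = D" and Y: "Y > 0"
  obtains E where "finite E" "card E \<le> D * (2 * Y + 1)"
    "\<And>k. k \<in> {..<N} - E \<Longrightarrow> poly f (int k) \<noteq> 0"
    "\<And>k. k \<in> {..<N} - E \<Longrightarrow> real D * ln (real Y / 2) \<le> ln (real_of_int \<bar>poly f (int k)\<bar>)"
proof (cases "N = 0")
  case True
  thus thesis using that[of "{}"] by simp
next
  case False
  hence "int ` {..<N} \<noteq> {}" by auto
  from abs_poly_lower_bound[OF f _ this] obtain es where es: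
    "length es = D" "\<And>k. k < N \<Longrightarrow> \<bar>\<Prod>e\<leftarrow>es. int k - e\<bar> \<le> 2 ^ D * \<bar>poly f (int k)\<bar>" by blast
  define near where "near = (\<lambda>e. {k. \<bar>int k - e\<bar> \<le> int Y})"
  have near: "finite (near e)" "card (near e) \<le> 2 * Y + 1" for e
  proof -
    have *: "int ` near e \<subseteq> {e - int Y..e + int Y}" by (auto simp: near_def)
    hence "finite (int ` near e)" by (rule finite_subset) simp
    thus "finite (near e)" by (rule finite_imageD) simp
    have "card (near e) = card (int ` near e)" by (rule card_image [symmetric]) simp
    also have "\<dots> \<le> card {e - int Y..e + int Y}" using * by (intro card_mono) auto
    finally show "card (near e) \<le> 2 * Y + 1" by simp
  qed
  define E where "E = (\<Union>e\<in>set es. near e)"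
  have far: "real Y ^ D \<le> 2 ^ D * real_of_int \<bar>poly f (int k)\<bar>" if k: "k \<in> {..<N} - E" for k
  proof -
    have "int Y ^ length es \<le> \<bar>\<Prod>e\<leftarrow>es. int k - e\<bar>"
      using k unfolding E_def
    proof (induction es)
      case (Cons e es)
      have "int Y * int Y ^ length es \<le> \<bar>int k - e\<bar> * \<bar>\<Prod>e\<leftarrow>es. int k - e\<bar>"
        using Cons by (intro mult_mono) (auto simp: near_def)
      thus ?case by (simp add: abs_mult)
    qed simp
    also have "\<dots> \<le> 2 ^ D * \<bar>poly f (int k)\<bar>" using k by (intro es(2)) auto
    finally have "real_of_int (int Y ^ D) \<le> real_of_int (2 ^ D * \<bar>poly f (int k)\<bar>)"
      by (subst of_int_le_iff) (simp add: es(1))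
    thus ?thesis by simp
  qed
  show thesis
  proof (rule that[of E])
    show "finite E" by (simp add: E_def near)
    have "card E \<le> (\<Sum>e\<in>set es. card (near e))" unfolding E_def by (rule card_UN_le) simp
    also have "\<dots> \<le> (\<Sum>e\<in>set es. 2 * Y + 1)" by (intro sum_mono near)
    also have "\<dots> \<le> D * (2 * Y + 1)" using card_length[of es] es(1) by (simp del: mult_Suc_right)
    finally show "card E \<le> D * (2 * Y + 1)" .
  next
    fix k assume k: "k \<in> {..<N} - E"
    have pos: "(real Y / 2) ^ D > 0" using Y by simp
    have le: "(real Y / 2) ^ D \<le> real_of_int \<bar>poly f (int k)\<bar>"
      using far[OF k] by (simp add: power_divide field_simps)
    with pos show "poly f (int k) \<noteq> 0" by (metis abs_zero not_less of_int_0)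
    have "real D * ln (real Y / 2) = ln ((real Y / 2) ^ D)" using Y by (simp add: ln_realpow)
    also have "\<dots> \<le> ln (real_of_int \<bar>poly f (int k)\<bar>)" using le pos by (intro ln_mono) auto
    finally show "real D * ln (real Y / 2) \<le> ln (real_of_int \<bar>poly f (int k)\<bar>)" .
  qed
qed

text \<open>Apart from the exceptional indices, which the two middle terms count, the indices
  outside the counted set have values composed of primes up to M. Summing ln |f k| over these, each
  value contributes at least D ln (Y / 2), while all primes together contribute at most D N (ln M +
  C). The degree cancels.\<close>

lemma card_poly_values_with_large_prime_factor:
  fixes f :: "int poly"
  assumes f: "content f = 1" "degree f = D" "D > 0" and M: "M > 0" and Y: "Y \<ge> 3"
    and C: "(\<Sum>p | prime p \<and> p \<le> M. ln (real p) / (real p - 1)) \<le> ln (real M) + C"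
  shows "real N \<le> real (card {k. k < N \<and> poly f (int k) \<noteq> 0 \<and> (\<exists>p. prime p \<and> p > M \<and> int p dvd poly f (int k))})
     + real D * (2 * real Y + 1) + real D * real M + real N * ((ln (real M) + C) / ln (real Y / 2))"
proof -
  define R where "R = {k. k < N \<and> poly f (int k) \<noteq> 0 \<and> (\<exists>p. prime p \<and> p > M \<and> int p dvd poly f (int k))}"
  define P where "P = {p. prime p \<and> p \<le> M}"
  have "P \<subseteq> {1..M}" unfolding P_def using prime_ge_1_nat by auto
  hence P: "finite P" "\<And>p. p \<in> P \<Longrightarrow> prime p" "card P \<le> M"
    using card_mono[of "{1..M}" P] finite_subset by (auto simp: P_def)
  have f0: "f \<noteq> 0" using f by auto
  obtain E where E: "finite E" "card E \<le> D * (2 * Y + 1)"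
    "\<And>k. k \<in> {..<N} - E \<Longrightarrow> poly f (int k) \<noteq> 0"
    "\<And>k. k \<in> {..<N} - E \<Longrightarrow> real D * ln (real Y / 2) \<le> ln (real_of_int \<bar>poly f (int k)\<bar>)"
    using ln_abs_poly_lower_bound[OF f0 f(2), of Y N] Y by (metis (full_types) gr0I not_numeral_le_zero)
  have "\<exists>E'. finite E' \<and> card E' \<le> D \<and>
    (\<forall>T. T \<subseteq> {..<N} - E' \<longrightarrow> (\<forall>k\<in>T. poly f (int k) \<noteq> 0) \<longrightarrow>
    (p - 1) * (\<Sum>k\<in>T. multiplicity p (nat \<bar>poly f (int k)\<bar>)) \<le> D * N)" if "p \<in> P" for p
    using sum_multiplicity_poly_le[OF P(2)[OF that] f(1) eq_refl[OF f(2)], of N] by (metis (no_types, lifting))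
  then obtain E' where E': "\<And>p. p \<in> P \<Longrightarrow> finite (E' p)" "\<And>p. p \<in> P \<Longrightarrow> card (E' p) \<le> D"
    "\<And>p T. p \<in> P \<Longrightarrow> T \<subseteq> {..<N} - E' p \<Longrightarrow> (\<forall>k\<in>T. poly f (int k) \<noteq> 0) \<Longrightarrow>
      (p - 1) * (\<Sum>k\<in>T. multiplicity p (nat \<bar>poly f (int k)\<bar>)) \<le> D * N" by metis
  define F where "F = (\<Union>p\<in>P. E' p)"
  have F: "finite F" using P E' by (auto simp: F_def)
  have "card F \<le> (\<Sum>p\<in>P. card (E' p))" unfolding F_def by (rule card_UN_le) (rule P(1))
  also have "\<dots> \<le> (\<Sum>p\<in>P. D)" by (intro sum_mono E')
  also have "\<dots> \<le> D * M" using P(3) by simp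
  finally have cardF: "card F \<le> D * M" .
  define T where "T = {..<N} - (E \<union> F \<union> R)"
  have finR: "finite R" by (auto simp: R_def)
  have T: "finite T" "T \<subseteq> {..<N} - E" "\<And>p. p \<in> P \<Longrightarrow> T \<subseteq> {..<N} - E' p"
    and Tnz: "\<And>k. k \<in> T \<Longrightarrow> poly f (int k) \<noteq> 0"
    using E(3) by (auto simp: T_def F_def)
  have "{..<N} \<subseteq> E \<union> F \<union> R \<union> T" by (auto simp: T_def)
  hence "N \<le> card (E \<union> F \<union> R \<union> T)"
    using card_mono[of "E \<union> F \<union> R \<union> T" "{..<N}"] E F finR T by simp
  also have "\<dots> \<le> card E + card F + card R + card T"
    using card_Un_le[of "E \<union> F \<union> R" T] card_Un_le[of "E \<union> F" R] card_Un_le[of E F] by linarith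
  finally have "N \<le> D * (2 * Y + 1) + D * M + card R + card T" using E(2) cardF by linarith
  hence N: "real N \<le> real D * (2 * real Y + 1) + real D * real M + real (card R) + real (card T)"
    by (metis (mono_tags, opaque_lifting) of_nat_1 of_nat_add of_nat_le_iff of_nat_mult of_nat_numeral)
  have ln: "ln (real_of_int \<bar>poly f (int k)\<bar>) = (\<Sum>p\<in>P. real (multiplicity p (nat \<bar>poly f (int k)\<bar>)) * ln (real p))"
    if k: "k \<in> T" for k
  proof -
    have "prime_factors (nat \<bar>poly f (int k)\<bar>) \<subseteq> P"
    proof
      fix p assume "p \<in> prime_factors (nat \<bar>poly f (int k)\<bar>)"
      hence "prime p" "int p dvd poly f (int k)" by (auto simp: prime_factors_dvd dvd_nat_abs_iff)
      moreover have "k < N" "k \<notin> R" using k by (auto simp: T_def)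
      ultimately show "p \<in> P" using Tnz[OF k] by (auto simp: R_def P_def not_less)
    qed
    from ln_eq_sum_multiplicity[OF _ P(1,2) this] Tnz[OF k] show ?thesis by simp
  qed
  have "real (card T) * (real D * ln (real Y / 2)) = (\<Sum>k\<in>T. real D * ln (real Y / 2))" by simp
  also have "\<dots> \<le> (\<Sum>k\<in>T. ln (real_of_int \<bar>poly f (int k)\<bar>))"
    using T(2) by (intro sum_mono E(4)) auto
  also have "\<dots> = (\<Sum>k\<in>T. \<Sum>p\<in>P. real (multiplicity p (nat \<bar>poly f (int k)\<bar>)) * ln (real p))"
    by (intro sum.cong ln refl)
  also have "\<dots> = (\<Sum>p\<in>P. real (\<Sum>k\<in>T. multiplicity p (nat \<bar>poly f (int k)\<bar>)) * ln (real p))"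
    by (subst sum.swap) (simp add: sum_distrib_right)
  also have "\<dots> \<le> (\<Sum>p\<in>P. (real D * real N / (real p - 1)) * ln (real p))"
  proof (intro sum_mono mult_right_mono)
    fix p assume p: "p \<in> P"
    have p2: "p \<ge> 2" using P(2)[OF p] by (rule prime_ge_2_nat)
    have "(p - 1) * (\<Sum>k\<in>T. multiplicity p (nat \<bar>poly f (int k)\<bar>)) \<le> D * N"
      using E'(3)[OF p T(3)[OF p]] Tnz by blast
    hence "real ((p - 1) * (\<Sum>k\<in>T. multiplicity p (nat \<bar>poly f (int k)\<bar>))) \<le> real (D * N)"
      by (rule of_nat_mono)
    hence "(real p - 1) * real (\<Sum>k\<in>T. multiplicity p (nat \<bar>poly f (int k)\<bar>)) \<le> real D * real N"
      using p2 by (simp add: of_nat_diff del: of_nat_sum)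
    thus "real (\<Sum>k\<in>T. multiplicity p (nat \<bar>poly f (int k)\<bar>)) \<le> real D * real N / (real p - 1)"
      using p2 by (simp add: field_simps del: of_nat_sum)
    show "0 \<le> ln (real p)" using p2 by simp
  qed
  also have "\<dots> = real D * real N * (\<Sum>p\<in>P. ln (real p) / (real p - 1))"
    by (simp add: sum_distrib_left)
  also have "\<dots> \<le> real D * real N * (ln (real M) + C)"
    using C by (intro mult_left_mono) (auto simp: P_def)
  finally have "real D * (real (card T) * ln (real Y / 2)) \<le> real D * (real N * (ln (real M) + C))"
    by (simp add: ac_simps)
  hence "real (card T) * ln (real Y / 2) \<le> real N * (ln (real M) + C)"
    using f(3) by simp
  moreover have "ln (real Y / 2) > 0" using Y by simp
  ultimately have "real (card T) \<le> real N * ((ln (real M) + C) / ln (real Y / 2))"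
    by (simp add: field_simps)
  with N show ?thesis by (simp add: R_def)
qed

section \<open>The length bound\<close>

lemma card_residue_class_le:
  fixes p :: nat
  assumes "p > 0"
  shows "card {l. l < N \<and> int p dvd int l - int k} \<le> N div p + 1"
proof -
  let ?S = "{l. l < N \<and> int p dvd int l - int k}"
  have "inj_on (\<lambda>l. l div p) ?S"
  proof (rule inj_onI)
    fix l l' assume *: "l \<in> ?S" "l' \<in> ?S" "l div p = l' div p"
    hence "l mod p = l' mod p"
      by (metis (no_types, lifting) mem_Collect_eq mod_eq_dvd_iff of_nat_eq_iff of_nat_mod)
    with * show "l = l'" by (metis div_mult_mod_eq)
  qed
  moreover have "(\<lambda>l. l div p) ` ?S \<subseteq> {..N div p}" by (auto intro: div_le_mono)
  ultimately have "card ?S \<le> card {..N div p}" by (intro card_inj_on_le) auto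
  thus ?thesis by simp
qed

lemma power_self_less_of_ln_less:
  assumes "N > 0" "real n \<le> x" "x * ln (2 * y) < real N * ln (5 / 4)" "real n \<le> y"
  shows "real (2 * n) ^ n < (5 / 4) ^ N"
proof (cases "n = 0")
  case True
  thus ?thesis using assms(1) by (simp add: one_less_power)
next
  case False
  have "ln (real (2 * n) ^ n) = real n * ln (real (2 * n))"
    by (rule ln_realpow)
  also have "\<dots> \<le> x * ln (2 * y)" using assms False by (intro mult_mono) auto
  also have "\<dots> < real N * ln (5 / 4)" by fact
  also have "\<dots> = ln ((5 / 4) ^ N)" by (simp add: ln_realpow)
  finally show ?thesis using False by (subst (asm) ln_less_cancel_iff) auto
qed

text \<open>Here \<open>x = N\<close>, \<open>n \<le> x powr \<theta>\<close>; primes are split at \<open>M = x powr \<mu>\<close>, and a value of the minimal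
  polynomial of degree \<open>D\<close> counts as large if it exceeds \<open>(x powr \<nu> / 4) ^ D\<close>.\<close>

lemma product_set_AP_length_bound:
  fixes B :: "complex set" and \<theta> \<mu> \<nu> c C :: real
  defines "n \<equiv> card B"
  assumes B: "finite B" and d: "d \<noteq> 0"
    and AP: "\<And>k. k < N \<Longrightarrow> d * (of_nat k - \<rho>) \<in> {b * b' | b b'. b \<in> B \<and> b' \<in> B}"
    and C: "\<And>n. n > 0 \<Longrightarrow> (\<Sum>p | prime p \<and> p \<le> n. ln (real p) / (real p - 1)) \<le> ln (real n) + C"
    and params: "0 < \<theta>" "\<theta> < \<mu>" "\<mu> < \<nu>" "\<nu> < 1" "0 < c" "0 \<le> C"
    and x: "x = real N" "1 \<le> x" "real n \<le> x powr \<theta>"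
    and large: "x powr \<theta> * ln (2 * x) < x * ln (5 / 4)" "8 \<le> x powr \<nu>" "2 \<le> x powr \<mu>"
    and count: "(2 * log 2 x + 6) * (2 * x powr \<nu> + 1) + (2 * log 2 x + 6) * x powr \<mu> +
      x * ((\<mu> * ln x + C) / (\<nu> * ln x - ln 4)) + c * x \<le> x"
  shows "c / 3 * x powr \<mu> * ln 2 \<le> x powr \<theta> * ln (2 * x + 1)"
proof -
  have "x powr \<theta> \<le> x powr 1" using x params by (intro powr_mono) auto
  hence nN: "real n \<le> x" using x by simp
  have walk: "real (2 * card B) ^ card B < (5 / 4) ^ N"
    using power_self_less_of_ln_less[OF _ x(3) _ nN, of N] large(1) x(1,2) by (simp add: n_def)
  \<comment> \<open>The least L with 2^L >= 4x, hence 2^L >= 4n. It is at most log 2 x + 3, which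
    bounds the degree \<open>2 * L\<close> by the factor \<open>2 * log 2 x + 6\<close> in
    \<open>count\<close>.\<close>
  define L where "L = nat \<lceil>log 2 (4 * x)\<rceil>"
  have "0 \<le> log 2 (4 * x)" using x by simp
  hence L: "log 2 (4 * x) \<le> real L" "real L \<le> log 2 (4 * x) + 1" unfolding L_def by linarith+
  have "4 * x \<le> 2 powr real L" using L(1) x by (simp add: log_le_iff)
  hence "real (4 * card B) \<le> real (2 ^ L)" using nN by (simp add: powr_realpow n_def)
  hence "4 * card B \<le> 2 ^ L" by (subst (asm) of_nat_le_iff)
  from exists_low_degree_poly[OF B d AP walk this] obtain h :: "int poly" where
    h: "h \<noteq> 0" "degree h \<le> 2 * L" "poly (map_poly of_int h) \<rho> = 0" by blast
  obtain f :: "int poly" where f: "f \<noteq> 0" "content f = 1" "0 < degree f" "degree f \<le> degree h"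
    "\<And>q. poly (map_poly of_int q) \<rho> = 0 \<Longrightarrow> f dvd q"
    using exists_primitive_int_minimal_poly[OF h(1,3)] by blast
  define D where "D = degree f"
  have "log 2 (4 * x) = log 2 4 + log 2 x" using x by (intro log_mult_pos) auto
  moreover have "log 2 4 = (2 :: real)" using log_pow_cancel[of "2 :: real" 2] by simp
  ultimately have D: "real D \<le> 2 * log 2 x + 6" "D > 0" using f(3,4) h(2) L(2) by (auto simp: D_def)
  define M Y where "M = nat \<lfloor>x powr \<mu>\<rfloor>" and "Y = nat \<lfloor>x powr \<nu>\<rfloor>"
  have M: "real M \<le> x powr \<mu>" "x powr \<mu> - 1 \<le> real M" 
    unfolding M_def using powr_ge_zero[of x \<mu>] by linarith+
  have Y: "real Y \<le> x powr \<nu>" "x powr \<nu> - 1 \<le> real Y" 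
    unfolding Y_def using powr_ge_zero[of x \<nu>] by linarith+
  have M0: "M > 0" and Y3: "Y \<ge> 3" using M Y large by linarith+
  define R where "R = {k. k < N \<and> poly f (int k) \<noteq> 0 \<and> (\<exists>p. prime p \<and> p > M \<and> int p dvd poly f (int k))}"
  have frac: "(ln (real M) + C) / ln (real Y / 2) \<le> (\<mu> * ln x + C) / (\<nu> * ln x - ln 4)"
  proof (rule frac_le)
    have "ln (real M) \<le> ln (x powr \<mu>)" using M M0 by (intro ln_mono) auto
    thus "ln (real M) + C \<le> \<mu> * ln x + C" using x by (simp add: ln_powr)
    have "ln (x powr \<nu> / 4) \<le> ln (real Y / 2)" using Y large Y3 by (intro ln_mono) auto
    thus "\<nu> * ln x - ln 4 \<le> ln (real Y / 2)" using x large by (simp add: ln_div ln_powr)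
    have "ln (8 / 4) \<le> ln (x powr \<nu> / 4)" using large by (intro ln_mono) auto
    hence "ln 2 \<le> \<nu> * ln x - ln 4" using x by (simp add: ln_div ln_powr)
    thus "0 < \<nu> * ln x - ln 4" by (rule less_le_trans[rotated]) simp
    show "0 \<le> \<mu> * ln x + C" using x params by simp
  qed
  have "0 \<le> log 2 x" using x by simp
  have "real N \<le> real (card R) + real D * (2 * real Y + 1) + real D * real M
      + real N * ((ln (real M) + C) / ln (real Y / 2))"
    unfolding R_def
    by (rule card_poly_values_with_large_prime_factor[OF f(2) _ D(2) M0 Y3 C[OF M0]]) (simp add: D_def)
  also have "\<dots> \<le> real (card R) + (2 * log 2 x + 6) * (2 * x powr \<nu> + 1) + (2 * log 2 x + 6) * x powr \<mu>
      + real N * ((\<mu> * ln x + C) / (\<nu> * ln x - ln 4))"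
    using D(1) M(1) Y(1) \<open>0 \<le> log 2 x\<close> frac by (intro add_mono mult_mono mult_left_mono[OF frac]) auto
  finally have R: "c * x \<le> real (card R)" using count unfolding x(1) [symmetric] by linarith
  have "\<exists>p. prime p \<and> p > M \<and> int p dvd poly f (int k)" if "k \<in> R" for k using that by (auto simp: R_def)
  then obtain p where p: "\<And>k. k \<in> R \<Longrightarrow> prime (p k)" "\<And>k. k \<in> R \<Longrightarrow> p k > M"
    "\<And>k. k \<in> R \<Longrightarrow> int (p k) dvd poly f (int k)" by metis
  have finR: "finite R" by (simp add: R_def)
  have "card {l \<in> R. int (p k) dvd int l - int k} \<le> N div M + 1" if k: "k \<in> R" for k
  proof -
    have "card {l \<in> R. int (p k) dvd int l - int k} \<le> card {l. l < N \<and> int (p k) dvd int l - int k}"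
      by (intro card_mono) (auto simp: R_def)
    also have "\<dots> \<le> N div p k + 1" using p(2)[OF k] by (intro card_residue_class_le) auto
    also have "\<dots> \<le> N div M + 1" using p(2)[OF k] M0 by (simp add: div_le_mono2)
    finally show ?thesis .
  qed
  from exists_large_isolated_subset[where P = "\<lambda>k l. int (p k) dvd int l - int k", OF finR _ this]
  obtain A where A: "A \<subseteq> R" "card R \<le> (N div M + 1) * card A"
    "\<And>A'. A' \<subseteq> A \<Longrightarrow> A' \<noteq> {} \<Longrightarrow> \<exists>k\<in>A'. \<forall>l\<in>A'. l \<noteq> k \<longrightarrow> \<not> int (p k) dvd int l - int k" by (auto simp del: mult_Suc)
  have finA: "finite A" using A(1) finR finite_subset by blast
  \<comment> \<open>If \<open>\<rho>\<close> were k, then f would divide X - k with a constant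
    cofactor and vanish at k, but R contains no zeros of f.\<close>
  have nz: "of_nat k \<noteq> \<rho>" if "k \<in> A" for k
  proof
    assume "of_nat k = \<rho>"
    hence "poly (map_poly of_int [:- int k, 1:]) \<rho> = 0" by (simp add: map_poly_pCons)
    from f(5)[OF this] obtain q where q: "[:- int k, 1:] = f * q" by (elim dvdE)
    have "degree f + degree q = 1"
      using q f(1) by (metis degree_mult_eq degree_pCons_eq_if mult_zero_right one_neq_zero One_nat_def pCons_eq_0_iff degree_0)
    then obtain a where a: "q = [:a:]" using f(3) degree_eq_zeroE by (metis add_cancel_right_right add_diff_cancel_left' diff_is_0_eq less_one not_less)
    have "poly f (int k) * a = 0"
      using arg_cong[OF q, of "\<lambda>q. poly q (int k)"] by (simp add: a mult.commute)
    moreover have "a \<noteq> 0" using q a by auto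
    ultimately show False using that A(1) by (auto simp: R_def)
  qed
  have "2 ^ card A \<le> (2 * card A + 1) ^ card B"
  proof (rule isolated_primes_bound[OF B finA d _ f(5)])
    fix k assume "k \<in> A"
    hence k: "k \<in> R" "k < N" using A(1) by (auto simp: R_def)
    show "d * (of_nat k - \<rho>) \<in> {b * b' | b b'. b \<in> B \<and> b' \<in> B}" by (rule AP[OF k(2)])
    show "prime (p k)" "int (p k) dvd poly f (int k)" using p[OF k(1)] by blast+
  qed (use A(3) nz in blast)+
  hence "real (2 ^ card A) \<le> real ((2 * card A + 1) ^ card B)" by (rule of_nat_mono)
  hence "ln (real (2 ^ card A)) \<le> ln (real ((2 * card A + 1) ^ card B))" by (intro ln_mono) auto
  hence "real (card A) * ln 2 \<le> real n * ln (real (2 * card A + 1))"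
    by (simp add: ln_realpow n_def add_pos_nonneg)
  also have "\<dots> \<le> x powr \<theta> * ln (2 * x + 1)"
  proof (intro mult_mono x(3) ln_mono)
    have "card A \<le> card {..<N}" using A(1) by (intro card_mono) (auto simp: R_def)
    thus "real (2 * card A + 1) \<le> 2 * x + 1" using x by simp
  qed auto
  finally have A': "real (card A) * ln 2 \<le> x powr \<theta> * ln (2 * x + 1)" .
  \<comment> \<open>Rounding down to M loses at most a factor 2 because x powr \<open>\<mu>\<close>
    is at least 2. The summand 1 is at most x / x powr \<open>\<mu>\<close>; this makes the constant
    3.\<close>
  have "real (N div M + 1) \<le> x / (x powr \<mu> / 2) + 1"
  proof -
    have "real (N div M) \<le> x / real M" using x(1) of_nat_div_le_of_nat[of N M] by simp
    also have "\<dots> \<le> x / (x powr \<mu> / 2)" using M large x by (intro divide_left_mono) auto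
    finally show ?thesis by simp
  qed
  also have "\<dots> \<le> 3 * (x / x powr \<mu>)"
  proof -
    have "x powr \<mu> \<le> x powr 1" using x params by (intro powr_mono) auto
    thus ?thesis using x large by (simp add: field_simps)
  qed
  finally have *: "real (N div M + 1) \<le> 3 * (x / x powr \<mu>)" .
  have "c * x \<le> real (N div M + 1) * real (card A)"
    using R A(2) by (metis of_nat_le_iff of_nat_mult order_trans)
  also have "\<dots> \<le> 3 * (x / x powr \<mu>) * real (card A)" using * by (intro mult_right_mono) auto
  finally have "c * x \<le> 3 * (x / x powr \<mu>) * real (card A)" .
  moreover have "x powr \<mu> > 0" using large(3) by linarith
  ultimately have "x * (c * x powr \<mu>) \<le> x * (3 * real (card A))"
    by (simp add: field_simps)
  hence "c * x powr \<mu> \<le> 3 * real (card A)" using x by simp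
  hence "c / 3 * x powr \<mu> * ln 2 \<le> real (card A) * ln 2" by (intro mult_right_mono) auto
  with A' show ?thesis by linarith
qed

section \<open>Asymptotics, choice of exponents and conclusion\<close>

lemma eventually_length_bound_parameters:
  fixes \<theta> \<mu> \<nu> c C :: real
  assumes "0 < \<theta>" "\<theta> < \<mu>" "\<mu> < \<nu>" "\<nu> < 1" "0 < c" "c < 1 - \<mu> / \<nu>"
  shows "eventually (\<lambda>x. x powr \<theta> * ln (2 * x) < x * ln (5 / 4) \<and> 8 \<le> x powr \<nu> \<and> 2 \<le> x powr \<mu> \<and>
    (2 * log 2 x + 6) * (2 * x powr \<nu> + 1) + (2 * log 2 x + 6) * x powr \<mu> +
      x * ((\<mu> * ln x + C) / (\<nu> * ln x - ln 4)) + c * x \<le> x \<and>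
    x powr \<theta> * ln (2 * x + 1) < c / 3 * x powr \<mu> * ln 2) at_top"
proof -
  \<comment> \<open>After division by x, the exceptional terms tend to 0 and the quotient of
    logarithms tends to \<open>\<mu>\<close> / \<open>\<nu>\<close>, so any c below 1 -
    \<open>\<mu>\<close> / \<open>\<nu>\<close> is eventually admissible.\<close>
  define g where "g = (\<lambda>x. (2 * log 2 x + 6) * (2 * x powr \<nu> + 1) / x + (2 * log 2 x + 6) * x powr \<mu> / x +
      (\<mu> * ln x + C) / (\<nu> * ln x - ln 4))"
  have "((\<lambda>x. (2 * log 2 x + 6) * (2 * x powr \<nu> + 1) / x) \<longlongrightarrow> 0) at_top"
    "((\<lambda>x. (2 * log 2 x + 6) * x powr \<mu> / x) \<longlongrightarrow> 0) at_top"
    "((\<lambda>x. (\<mu> * ln x + C) / (\<nu> * ln x - ln 4)) \<longlongrightarrow> \<mu> * inverse \<nu>) at_top"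
    using assms by real_asymp+
  hence "(g \<longlongrightarrow> 0 + 0 + \<mu> * inverse \<nu>) at_top" unfolding g_def by (intro tendsto_add)
  hence "eventually (\<lambda>x. g x < 1 - c) at_top"
    by (rule order_tendstoD) (use assms in \<open>simp add: divide_inverse\<close>)
  hence count: "eventually (\<lambda>x. (2 * log 2 x + 6) * (2 * x powr \<nu> + 1) + (2 * log 2 x + 6) * x powr \<mu> +
      x * ((\<mu> * ln x + C) / (\<nu> * ln x - ln 4)) + c * x \<le> x) at_top"
    using eventually_gt_at_top[of 0]
  proof eventually_elim
    case (elim x)
    hence "x * g x \<le> x * (1 - c)" by (intro mult_left_mono) auto
    moreover have "x * g x = (2 * log 2 x + 6) * (2 * x powr \<nu> + 1) + (2 * log 2 x + 6) * x powr \<mu> +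
      x * ((\<mu> * ln x + C) / (\<nu> * ln x - ln 4))"
      using elim unfolding g_def distrib_left by simp
    ultimately show ?case by (simp add: right_diff_distrib mult.commute)
  qed
  have "eventually (\<lambda>x. x powr \<theta> * ln (2 * x) < x * ln (5 / 4)) at_top"
    "eventually (\<lambda>x. 8 \<le> x powr \<nu>) at_top" "eventually (\<lambda>x. 2 \<le> x powr \<mu>) at_top"
    "eventually (\<lambda>x. x powr \<theta> * ln (2 * x + 1) < c / 3 * x powr \<mu> * ln 2) at_top"
    using assms by real_asymp+
  with count show ?thesis by (intro eventually_conj)
qed

theorem theorem2:
  assumes "GRH"
  shows "\<forall>\<epsilon>::real. \<epsilon> > 0 \<longrightarrow> (\<exists>C::real. C > 0 \<and>
     (\<forall>(B::complex set) (n::nat) (N::nat) (a::complex) (d::complex).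
        finite B \<and> card B = n \<and> d \<noteq> 0 \<and>
        (\<forall>k<N. a + of_nat k * d \<in> {b * b' | b b'. b \<in> B \<and> b' \<in> B}) \<longrightarrow>
        real N \<le> C * real n powr (1 + \<epsilon>)))"
proof (intro allI impI)
  fix \<epsilon> :: real assume \<epsilon>: "\<epsilon> > 0"
  \<comment> \<open>With this \<open>\<theta>\<close>, n^(1 + \<open>\<epsilon>\<close>) <= N
    becomes n <= N^\<open>\<theta>\<close>. The exponents \<open>\<mu>\<close> and
    \<open>\<nu>\<close> are successive midpoints towards 1, and c is half of the available
    proportion.\<close>
  define \<theta> where "\<theta> = 1 / (1 + \<epsilon>)"
  define \<mu> where "\<mu> = (1 + \<theta>) / 2"
  define \<nu> where "\<nu> = (1 + \<mu>) / 2"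
  define c where "c = (1 - \<mu> / \<nu>) / 2"
  have "0 < \<theta>" "\<theta> < 1" using \<epsilon> by (auto simp: \<theta>_def)
  hence params: "0 < \<theta>" "\<theta> < \<mu>" "\<mu> < \<nu>" "\<nu> < 1" by (auto simp: \<mu>_def \<nu>_def)
  hence "\<mu> / \<nu> < 1" by simp
  hence c: "0 < c" "c < 1 - \<mu> / \<nu>" by (auto simp: c_def)
  obtain C0 where C0: "\<And>n. n > 0 \<Longrightarrow>
      (\<Sum>p | prime p \<and> p \<le> n. ln (real p) / (real p - 1)) \<le> ln (real n) + C0"
    using mertens_upper_bound by blast
  \<comment> \<open>Nonnegativity keeps the numerator \<open>\<mu> * ln x + C\<close> nonnegative
    when fractions are compared.\<close>
  define C where "C = max C0 0"
  have C: "(\<Sum>p | prime p \<and> p \<le> n. ln (real p) / (real p - 1)) \<le> ln (real n) + C" if "n > 0" for n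
    using C0[OF that] by (simp add: C_def)
  obtain X where X: "\<And>x. x \<ge> X \<Longrightarrow>
      x powr \<theta> * ln (2 * x) < x * ln (5 / 4) \<and> 8 \<le> x powr \<nu> \<and> 2 \<le> x powr \<mu> \<and>
      (2 * log 2 x + 6) * (2 * x powr \<nu> + 1) + (2 * log 2 x + 6) * x powr \<mu> +
        x * ((\<mu> * ln x + C) / (\<nu> * ln x - ln 4)) + c * x \<le> x \<and>
      x powr \<theta> * ln (2 * x + 1) < c / 3 * x powr \<mu> * ln 2"
    using eventually_length_bound_parameters[OF params c, of C]
    by (auto simp: eventually_at_top_linorder)
  \<comment> \<open>A counterexample has n >= 1, so N > K puts N in the asymptotic range from X on;
    K >= 1 gives n^(1 + \<open>\<epsilon>\<close>) <= N.\<close>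
  define K where "K = max X 1"
  show "\<exists>C>0. \<forall>(B::complex set) (n::nat) (N::nat) (a::complex) (d::complex).
        finite B \<and> card B = n \<and> d \<noteq> 0 \<and>
        (\<forall>k<N. a + of_nat k * d \<in> {b * b' | b b'. b \<in> B \<and> b' \<in> B}) \<longrightarrow>
        real N \<le> C * real n powr (1 + \<epsilon>)"
  proof (intro exI[of _ K] conjI allI impI, goal_cases)
    case 1
    show ?case by (simp add: K_def)
  next
    case (2 B n N a d)
    hence B: "finite B" "card B = n" and d: "d \<noteq> 0"
      and AP: "\<And>k. k < N \<Longrightarrow> a + of_nat k * d \<in> {b * b' | b b'. b \<in> B \<and> b' \<in> B}" by blast+
    show ?case
    proof (rule ccontr)
      assume "\<not> ?case"
      hence N: "real N > K * real n powr (1 + \<epsilon>)" by simp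
      have "0 \<le> K * real n powr (1 + \<epsilon>)" by (simp add: K_def)
      with N have "N > 0" by simp
      hence "B \<noteq> {}" using AP[of 0] by blast
      hence "n \<ge> 1" using B by (metis One_nat_def Suc_leI card_gt_0_iff)
      hence n: "real n powr (1 + \<epsilon>) \<ge> 1" using \<epsilon> by (intro ge_one_powr_ge_zero) auto
      have K: "1 \<le> K" "X \<le> K" by (auto simp: K_def)
      have "K * 1 \<le> K * real n powr (1 + \<epsilon>)" using n K by (intro mult_left_mono) auto
      hence NK: "real N \<ge> K" using N by simp
      have "1 * real n powr (1 + \<epsilon>) \<le> K * real n powr (1 + \<epsilon>)" using K by (intro mult_right_mono) auto
      hence "(real n powr (1 + \<epsilon>)) powr \<theta> \<le> real N powr \<theta>"
        using N params by (intro powr_mono2) auto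
      hence nN: "real (card B) \<le> real N powr \<theta>" using \<epsilon> by (simp add: \<theta>_def powr_powr B)
      have AP': "d * (of_nat k - (- a / d)) \<in> {b * b' | b b'. b \<in> B \<and> b' \<in> B}" if "k < N" for k
      proof -
        have "d * (of_nat k - (- a / d)) = a + of_nat k * d" using d by (simp add: field_simps)
        thus ?thesis using AP[OF that] by simp
      qed
      have "real N \<ge> X" "1 \<le> real N" using NK K by linarith+
      with X[of "real N"]
      have "c / 3 * real N powr \<mu> * ln 2 \<le> real N powr \<theta> * ln (2 * real N + 1)"
        by (intro product_set_AP_length_bound[OF B(1) d AP' C params c(1), where x = "real N"] nN)
           (auto simp: C_def)
      with X[OF \<open>real N \<ge> X\<close>] show False by linarith
    qed
  qed
qed

end
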